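(* Let $E$ be a vector lattice. Suppose that $E$ has an order dense ideal $F$ such that $F^{\sim}_{\mathrm{oc}}$ separates the points of $F$. Then $E$ admits a (necessarily unique) Hausdorff uo-Lebesgue topology $\widehat\tau_E$. Choose a subset $A$ of $F^\sim_{\mathrm{oc}}$ such that the ideal $I_A$ generated by $A$ in $F^\sim_{\mathrm{oc}}$ separates the points of $F$, and choose a subset $S$ of $F$ such that the ideal $I_S\subseteq F$ generated by $S$ is order dense in $E$. Then: (1) $\mathrm{u}_S|\sigma|(F,A)$ and $\mathrm{u}_F|\sigma|(F,I_A)$ are both equal to $\widehat\tau_E$; (2) for a net $(x_\alpha)_{\alpha\in\mathcal A}$ in $E$, $x_\alpha\to 0$ in $\widehat\tau_E$ if and only if $|\varphi|(|x_\alpha|\wedge|s|)\to 0$ for all $\varphi\in A$ and $s\in S$; equivalently, if and only if $|\varphi|(|x_\alpha|\wedge|y|)\to 0$ for all $\varphi\in F^\sim_{\mathrm{oc}}$ and $y\in F$.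
   Context: All vector lattices are real and Archimedean. A net $(x_\alpha)_{\alpha\in\mathcal A}$ in a vector lattice $E$ is order convergent to $x$ ($x_\alpha\xrightarrow{\mathrm o}x$) if there is a net $(y_\beta)_{\beta\in\mathcal B}$ in $E$ (possibly with a different index set) with $y_\beta\downarrow 0$ such that for every $\beta_0\in\mathcal B$ there is $\alpha_0\in\mathcal A$ with $|x-x_\alpha|\le y_{\beta_0}$ for all $\alpha\ge\alpha_0$. It is unbounded order convergent to $x$ ($x_\alpha\xrightarrow{\mathrm{uo}}x$) if $|x_\alpha-x|\wedge y\xrightarrow{\mathrm o}0$ in $E$ for all $y\in E^+$. $F^\sim_{\mathrm{oc}}$ is the vector lattice of order continuous linear functionals $F\to\mathbb R$ (those mapping nets order convergent to $0$ to nets convergent to $0$; these are automatically order bounded). A uo-Lebesgue topology on $E$ is a locally solid linear topology (a vector space topology, not necessarily Hausdorff, with a base of solid neighbourhoods of $0$) such that $x_\alpha\xrightarrow{\mathrm{uo}}x$ implies topological convergence $x_\alpha\to x$ for all nets. A vector sublattice $F$ of $E$ is order dense if for every $x\in E$ with $x>0$ there is $y\in F$ with $0<y\le x$. For a subset $A$ of the order dual of $F$, $|\sigma|(F,A)$ is the locally convex-solid topology on $F$ generated by the lattice seminorms $x\mapsto|\varphi|(|x|)$, $\varphi\in A$. For an ideal $F$ of $E$ with a locally solid linear topology $\tau_F$ and a subset $S$ of $F$, $\mathrm{u}_S\tau_F$ denotes the unique topology on $E$ making the additive group $E$ a topological group such that a net $x_\alpha\to 0$ in it if and only if $|x_\alpha|\wedge|s|\to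 0$ in $(F,\tau_F)$ for all $s\in S$ (such a topology exists). *)

theory Defs
  imports "HOL-Analysis.Analysis" "HOL-Library.Lattice_Algebras"
begin

section \<open>Archimedean vector lattices, ideals, order density\<close>

class archimedean_vector_lattice = ordered_real_vector + lattice_ab_group_add_abs +
  assumes archimedean: "(\<And>n::nat. real n *\<^sub>R x \<le> y) \<Longrightarrow> x \<le> 0"

definition solid_in :: "'a::archimedean_vector_lattice set \<Rightarrow> 'a set \<Rightarrow> bool" where
  "solid_in L V \<longleftrightarrow> V \<subseteq> L \<and> (\<forall>x\<in>L. \<forall>y\<in>V. \<bar>x\<bar> \<le> \<bar>y\<bar> \<longrightarrow> x \<in> V)"

definition lattice_ideal :: "'a::archimedean_vector_lattice set \<Rightarrow> bool" where
  "lattice_ideal F \<longleftrightarrow> subspace F \<and> solid_in UNIV F"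

definition order_dense :: "'a::archimedean_vector_lattice set \<Rightarrow> bool" where
  "order_dense F \<longleftrightarrow> (\<forall>x>0. \<exists>y\<in>F. 0 < y \<and> y \<le> x)"


section \<open>Nets\<close>

text \<open>
  A net is a function on a nonempty directed preordered set; \<open>(a, b) \<in> r\<close> reads \<open>a \<le> b\<close>.
  Limits of nets are library limits along the filter of tails.
\<close>

definition directed_set :: "'i set \<Rightarrow> 'i rel \<Rightarrow> bool" where
  "directed_set I r \<longleftrightarrow>
     I \<noteq> {} \<and> preorder_on I r \<and> (\<forall>a\<in>I. \<forall>b\<in>I. \<exists>c\<in>I. (a, c) \<in> r \<and> (b, c) \<in> r)"

definition tails :: "'i set \<Rightarrow> 'i rel \<Rightarrow> 'i filter" where
  "tails I r = (INF a\<in>I. principal {b \<in> I. (a, b) \<in> r})"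

lemma eventually_tails:
  assumes "directed_set I r"
  shows "eventually P (tails I r) \<longleftrightarrow> (\<exists>a\<in>I. \<forall>b\<in>I. (a, b) \<in> r \<longrightarrow> P b)"
proof -
  have "eventually P (tails I r) \<longleftrightarrow> (\<exists>a\<in>I. eventually P (principal {b \<in> I. (a, b) \<in> r}))"
    unfolding tails_def
  proof (rule eventually_INF_base)
    show "I \<noteq> {}" using assms by (simp add: directed_set_def)
    fix a b assume "a \<in> I" "b \<in> I"
    then obtain c where "c \<in> I" "(a, c) \<in> r" "(b, c) \<in> r"
      using assms by (meson directed_set_def)
    moreover have "trans r" using assms by (simp add: directed_set_def preorder_on_def)
    ultimately show "\<exists>c\<in>I. principal {d \<in> I. (c, d) \<in> r}
        \<le> inf (principal {d \<in> I. (a, d) \<in> r}) (principal {d \<in> I. (b, d) \<in> r})"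
      by (intro bexI[of _ c]) (auto dest: transD)
  qed
  then show ?thesis by (auto simp: eventually_principal)
qed

text \<open>
  HOL has no quantification over types inside a formula, so the definitions below that speak of
  ``all nets'' in \<open>'a\<close> quantify over nets whose index set lies in the type \<open>'a \<times> 'a set\<close>.
  This loses nothing: by the next lemma every net, over any index type, has the same tail filter
  as one of these with values in the same set. The lemmas called \<open>any_net\<close> below transfer each
  definition to arbitrary index types.
\<close>

lemma canonical_net:
  fixes x :: "'i \<Rightarrow> 'a"
  assumes dir: "directed_set I r"
  obtains J :: "('a \<times> 'a set) set" and s where
    "directed_set J s" "fst ` J \<subseteq> x ` I"
    "filtermap fst (tails J s) = filtermap x (tails I r)"
proof -
  let ?ev = "\<lambda>S. eventually (\<lambda>i. x i \<in> S) (tails I r)"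
  define J where "J = {(a, S). a \<in> S \<and> S \<subseteq> x ` I \<and> ?ev S}"
  define s where "s = {(p, q). p \<in> J \<and> q \<in> J \<and> snd q \<subseteq> snd p}"
  have all: "?ev (x ` I)"
    using dir by (auto simp: eventually_tails directed_set_def)
  have ne: "S \<noteq> {}" if "?ev S" for S
  proof -
    from that obtain a where a: "a \<in> I" "\<forall>b\<in>I. (a, b) \<in> r \<longrightarrow> x b \<in> S"
      unfolding eventually_tails[OF dir] by blast
    have "(a, a) \<in> r"
      using dir a(1) by (auto simp: directed_set_def preorder_on_def refl_on_def)
    with a show ?thesis by blast
  qed
  have dirJ: "directed_set J s"
    unfolding directed_set_def
  proof (intro conjI ballI)
    show "J \<noteq> {}" using all ne[OF all] by (auto simp: J_def)
    show "preorder_on J s"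
      by (auto simp: preorder_on_def s_def refl_on_def trans_def)
    fix p q assume pq: "p \<in> J" "q \<in> J"
    let ?S = "snd p \<inter> snd q"
    have ev: "?ev ?S" using pq by (auto simp: J_def eventually_conj_iff)
    then obtain a where a: "a \<in> ?S" using ne[OF ev] by blast
    have "(a, ?S) \<in> J" using pq a ev by (auto simp: J_def)
    then show "\<exists>c\<in>J. (p, c) \<in> s \<and> (q, c) \<in> s"
      using pq by (intro bexI[of _ "(a, ?S)"]) (auto simp: s_def)
  qed
  moreover have "fst ` J \<subseteq> x ` I" by (auto simp: J_def)
  moreover have "filtermap fst (tails J s) = filtermap x (tails I r)"
  proof (rule filter_eq_iff[THEN iffD2], rule allI)
    fix P
    show "eventually P (filtermap fst (tails J s)) \<longleftrightarrow> eventually P (filtermap x (tails I r))"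
      unfolding eventually_filtermap
    proof
      assume "eventually (\<lambda>p. P (fst p)) (tails J s)"
      then obtain a S where aS: "(a, S) \<in> J"
        and P: "\<forall>q\<in>J. ((a, S), q) \<in> s \<longrightarrow> P (fst q)"
        unfolding eventually_tails[OF dirJ] by auto
      have "P b" if "b \<in> S" for b
        using P aS that by (auto simp: J_def s_def)
      moreover have "?ev S" using aS by (simp add: J_def)
      ultimately show "eventually (\<lambda>i. P (x i)) (tails I r)"
        by (auto elim: eventually_mono)
    next
      assume P: "eventually (\<lambda>i. P (x i)) (tails I r)"
      define S where "S = {b \<in> x ` I. P b}"
      have "eventually (\<lambda>i. x i \<in> x ` I \<and> P (x i)) (tails I r)"
        using all P by (rule eventually_conj)
      then have ev: "?ev S" by (simp add: S_def)
      then obtain a where "a \<in> S" using ne[OF ev] by blast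
      then have "(a, S) \<in> J" using ev by (auto simp: J_def S_def)
      moreover have "P (fst q)" if "((a, S), q) \<in> s" for q
        using that by (auto simp: s_def J_def S_def)
      ultimately show "eventually (\<lambda>p. P (fst p)) (tails J s)"
        unfolding eventually_tails[OF dirJ] by blast
    qed
  qed
  ultimately show thesis by (rule that)
qed


section \<open>Order convergence and unbounded order convergence\<close>

text \<open>\<open>L\<close> is the vector lattice (a sublattice of \<open>'a\<close>) in which the infimum is taken.\<close>

definition decreases_to_zero ::
    "'a::archimedean_vector_lattice set \<Rightarrow> 'j set \<Rightarrow> 'j rel \<Rightarrow> ('j \<Rightarrow> 'a) \<Rightarrow> bool" where
  "decreases_to_zero L J s y \<longleftrightarrow>
     directed_set J s \<and> y ` J \<subseteq> L \<and>
     (\<forall>a\<in>J. \<forall>b\<in>J. (a, b) \<in> s \<longrightarrow> y b \<le> y a) \<and>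
     (\<forall>b\<in>J. 0 \<le> y b) \<and> (\<forall>z\<in>L. (\<forall>b\<in>J. z \<le> y b) \<longrightarrow> z \<le> 0)"

text \<open>
  The dominating net may be indexed by a subset of \<open>'a\<close> without loss of generality
  (lemma \<open>order_convergentI_any_net\<close>).
\<close>

definition order_convergent ::
    "'a::archimedean_vector_lattice set \<Rightarrow> 'i set \<Rightarrow> 'i rel \<Rightarrow> ('i \<Rightarrow> 'a) \<Rightarrow> 'a \<Rightarrow> bool" where
  "order_convergent L I r x l \<longleftrightarrow>
     x ` I \<subseteq> L \<and> l \<in> L \<and>
     (\<exists>(J :: 'a set) s y. decreases_to_zero L J s y \<and>
        (\<forall>b\<in>J. \<exists>a\<in>I. \<forall>c\<in>I. (a, c) \<in> r \<longrightarrow> \<bar>l - x c\<bar> \<le> y b))"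

definition uo_convergent ::
    "'i set \<Rightarrow> 'i rel \<Rightarrow> ('i \<Rightarrow> 'a::archimedean_vector_lattice) \<Rightarrow> 'a \<Rightarrow> bool" where
  "uo_convergent I r x l \<longleftrightarrow>
     (\<forall>y\<ge>0. order_convergent UNIV I r (\<lambda>i. inf \<bar>x i - l\<bar> y) 0)"

lemma order_convergentI_any_net:
  fixes y :: "'j \<Rightarrow> 'a::archimedean_vector_lattice"
  assumes "x ` I \<subseteq> L" "l \<in> L" and y: "decreases_to_zero L J s y"
    and dom: "\<forall>b\<in>J. \<exists>a\<in>I. \<forall>c\<in>I. (a, c) \<in> r \<longrightarrow> \<bar>l - x c\<bar> \<le> y b"
  shows "order_convergent L I r x l"
proof -
  let ?s = "{(u, v). u \<in> y ` J \<and> v \<in> y ` J \<and> v \<le> u}"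
  have dir: "directed_set J s" using y by (simp add: decreases_to_zero_def)
  have "directed_set (y ` J) ?s"
    unfolding directed_set_def
  proof (intro conjI ballI)
    show "y ` J \<noteq> {}" using dir by (simp add: directed_set_def)
    show "preorder_on (y ` J) ?s"
      by (auto simp: preorder_on_def refl_on_def trans_def)
    fix u v assume "u \<in> y ` J" "v \<in> y ` J"
    then obtain a b where ab: "a \<in> J" "b \<in> J" "u = y a" "v = y b" by blast
    then obtain c where "c \<in> J" "(a, c) \<in> s" "(b, c) \<in> s"
      using dir by (meson directed_set_def)
    with ab y show "\<exists>w\<in>y ` J. (u, w) \<in> ?s \<and> (v, w) \<in> ?s"
      by (intro bexI[of _ "y c"]) (auto simp: decreases_to_zero_def)
  qed
  then have "decreases_to_zero L (y ` J) ?s id"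
    using y by (auto simp: decreases_to_zero_def)
  with assms show ?thesis
    unfolding order_convergent_def
    by (intro conjI exI[of _ "y ` J"] exI[of _ ?s] exI[of _ id]) auto
qed

lemma order_convergent_filter:
  fixes x :: "'i \<Rightarrow> 'a::archimedean_vector_lattice"
  assumes "directed_set I r"
  shows "order_convergent L I r x l \<longleftrightarrow>
     x ` I \<subseteq> L \<and> l \<in> L \<and>
     (\<exists>(J :: 'a set) s y. decreases_to_zero L J s y \<and>
        (\<forall>b\<in>J. eventually (\<lambda>u. \<bar>l - u\<bar> \<le> y b) (filtermap x (tails I r))))"
  unfolding order_convergent_def eventually_filtermap eventually_tails[OF assms] ..

lemma uo_convergent_filter:
  fixes x :: "'i \<Rightarrow> 'a::archimedean_vector_lattice"
  assumes "directed_set I r"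
  shows "uo_convergent I r x l \<longleftrightarrow>
     (\<forall>z\<ge>0. \<exists>(J :: 'a set) s y. decreases_to_zero UNIV J s y \<and>
        (\<forall>b\<in>J. eventually (\<lambda>u. \<bar>0 - inf \<bar>u - l\<bar> z\<bar> \<le> y b) (filtermap x (tails I r))))"
  unfolding uo_convergent_def order_convergent_filter[OF assms] eventually_filtermap
  by simp


section \<open>Functionals\<close>

text \<open>
  A functional on \<open>F\<close> is represented by the function that extends it by zero outside \<open>F\<close>, so
  that equality and the pointwise operations of functionals are those of functions.
\<close>

definition functional_on :: "'a::real_vector set \<Rightarrow> ('a \<Rightarrow> real) \<Rightarrow> bool" where
  "functional_on F \<phi> \<longleftrightarrow>
     (\<forall>x\<in>F. \<forall>y\<in>F. \<phi> (x + y) = \<phi> x + \<phi> y) \<and>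
     (\<forall>c. \<forall>x\<in>F. \<phi> (c *\<^sub>R x) = c * \<phi> x) \<and>
     (\<forall>x. x \<notin> F \<longrightarrow> \<phi> x = 0)"

definition order_dual :: "'a::archimedean_vector_lattice set \<Rightarrow> ('a \<Rightarrow> real) set" where
  "order_dual F =
     {\<phi>. functional_on F \<phi> \<and> (\<forall>a\<in>F. \<forall>b\<in>F. bounded (\<phi> ` (F \<inter> {a..b})))}"

definition oc_dual :: "'a::archimedean_vector_lattice set \<Rightarrow> ('a \<Rightarrow> real) set" where
  "oc_dual F =
     {\<phi>. functional_on F \<phi> \<and>
        (\<forall>(I :: ('a \<times> 'a set) set) r x.
           directed_set I r \<longrightarrow> order_convergent F I r x 0 \<longrightarrow>
             ((\<lambda>i. \<phi> (x i)) \<longlongrightarrow> 0) (tails I r))}"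

lemma oc_dual_any_net:
  fixes x :: "'i \<Rightarrow> 'a::archimedean_vector_lattice"
  assumes "\<phi> \<in> oc_dual F" and dir: "directed_set I r" and x: "order_convergent F I r x 0"
  shows "((\<lambda>i. \<phi> (x i)) \<longlongrightarrow> 0) (tails I r)"
proof -
  obtain J :: "('a \<times> 'a set) set" and s where J: "directed_set J s" "fst ` J \<subseteq> x ` I"
    and eq: "filtermap fst (tails J s) = filtermap x (tails I r)"
    using canonical_net[OF dir] .
  have "order_convergent F J s fst 0"
    using x J(2) unfolding order_convergent_filter[OF dir] order_convergent_filter[OF J(1)] eq
    by blast
  then have "((\<lambda>p. \<phi> (fst p)) \<longlongrightarrow> 0) (tails J s)"
    using assms(1) J(1) unfolding oc_dual_def by blast
  then have "(\<phi> \<longlongrightarrow> 0) (filtermap fst (tails J s))"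
    by (simp add: filterlim_filtermap)
  then show ?thesis unfolding eq by (simp add: filterlim_filtermap)
qed

definition dual_le ::
    "'a::archimedean_vector_lattice set \<Rightarrow> ('a \<Rightarrow> real) \<Rightarrow> ('a \<Rightarrow> real) \<Rightarrow> bool" where
  "dual_le F \<phi> \<psi> \<longleftrightarrow> (\<forall>x\<in>F. 0 \<le> x \<longrightarrow> \<phi> x \<le> \<psi> x)"

text \<open>
  The modulus \<open>\<phi> \<squnion> (- \<phi>)\<close> in the order dual. The order continuous functionals form an ideal
  of the order dual, so this is also the modulus in \<open>oc_dual F\<close>.
\<close>

definition modulus ::
    "'a::archimedean_vector_lattice set \<Rightarrow> ('a \<Rightarrow> real) \<Rightarrow> 'a \<Rightarrow> real" where
  "modulus F \<phi> = (THE \<psi>. \<psi> \<in> order_dual F \<and> dual_le F \<phi> \<psi> \<and> dual_le F (\<lambda>x. - \<phi> x) \<psi> \<and>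
     (\<forall>\<xi>\<in>order_dual F. dual_le F \<phi> \<xi> \<longrightarrow> dual_le F (\<lambda>x. - \<phi> x) \<xi> \<longrightarrow> dual_le F \<psi> \<xi>))"

definition oc_dual_ideal ::
    "'a::archimedean_vector_lattice set \<Rightarrow> ('a \<Rightarrow> real) set \<Rightarrow> bool" where
  "oc_dual_ideal F I \<longleftrightarrow>
     I \<subseteq> oc_dual F \<and> (\<lambda>x. 0) \<in> I \<and>
     (\<forall>\<phi>\<in>I. \<forall>\<psi>\<in>I. (\<lambda>x. \<phi> x + \<psi> x) \<in> I) \<and>
     (\<forall>c. \<forall>\<phi>\<in>I. (\<lambda>x. c * \<phi> x) \<in> I) \<and>
     (\<forall>\<phi>\<in>oc_dual F. \<forall>\<psi>\<in>I. dual_le F (modulus F \<phi>) (modulus F \<psi>) \<longrightarrow> \<phi> \<in> I)"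

definition separates_points :: "('a \<Rightarrow> real) set \<Rightarrow> 'a set \<Rightarrow> bool" where
  "separates_points D F \<longleftrightarrow> (\<forall>x\<in>F. \<forall>y\<in>F. x \<noteq> y \<longrightarrow> (\<exists>\<phi>\<in>D. \<phi> x \<noteq> \<phi> y))"


section \<open>Topologies\<close>

definition locally_solid_topology ::
    "'a::archimedean_vector_lattice set \<Rightarrow> 'a topology \<Rightarrow> bool" where
  "locally_solid_topology L T \<longleftrightarrow>
     topspace T = L \<and>
     continuous_map (prod_topology T T) T (\<lambda>(x, y). x + y) \<and>
     continuous_map (prod_topology euclidean T) T (\<lambda>(c::real, x). c *\<^sub>R x) \<and>
     (\<forall>U. openin T U \<longrightarrow> 0 \<in> U \<longrightarrow>
        (\<exists>V W. solid_in L V \<and> V \<subseteq> U \<and> openin T W \<and> 0 \<in> W \<and> W \<subseteq> V))"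

definition uo_Lebesgue :: "'a::archimedean_vector_lattice topology \<Rightarrow> bool" where
  "uo_Lebesgue T \<longleftrightarrow>
     locally_solid_topology UNIV T \<and>
     (\<forall>(I :: ('a \<times> 'a set) set) r x l.
        directed_set I r \<longrightarrow> uo_convergent I r x l \<longrightarrow> limitin T x l (tails I r))"

lemma limitin_filtermap:
  "limitin T x l G \<longleftrightarrow> limitin T id l (filtermap x G)"
  by (simp add: limitin_def eventually_filtermap)

lemma uo_Lebesgue_any_net:
  fixes x :: "'i \<Rightarrow> 'a::archimedean_vector_lattice"
  assumes "uo_Lebesgue T" and dir: "directed_set I r" and x: "uo_convergent I r x l"
  shows "limitin T x l (tails I r)"
proof -
  obtain J :: "('a \<times> 'a set) set" and s where J: "directed_set J s"
    and eq: "filtermap fst (tails J s) = filtermap x (tails I r)"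
    using canonical_net[OF dir] .
  have "uo_convergent J s fst l"
    using x unfolding uo_convergent_filter[OF dir] uo_convergent_filter[OF J] eq .
  then have "limitin T fst l (tails J s)"
    using assms(1) J unfolding uo_Lebesgue_def by blast
  then show ?thesis
    unfolding limitin_filtermap[of T fst] limitin_filtermap[of T x] eq .
qed

text \<open>
  The topology \<open>|\<sigma>|(F, A)\<close>, generated by the open balls (about all points of \<open>F\<close>) of the
  seminorms \<open>x \<mapsto> |\<phi>|(|x|)\<close>. Adding \<open>F\<close> to the subbase only matters for empty \<open>A\<close>.
\<close>

definition abs_weak_topology ::
    "'a::archimedean_vector_lattice set \<Rightarrow> ('a \<Rightarrow> real) set \<Rightarrow> 'a topology" where
  "abs_weak_topology F A = topology_generated_by
     (insert F {{x \<in> F. modulus F \<phi> \<bar>x - a\<bar> < e} | \<phi> a e. \<phi> \<in> A \<and> a \<in> F \<and> 0 < e})"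

definition group_topology :: "'a::ab_group_add topology \<Rightarrow> bool" where
  "group_topology T \<longleftrightarrow>
     topspace T = UNIV \<and>
     continuous_map (prod_topology T T) T (\<lambda>(x, y). x + y) \<and>
     continuous_map T T uminus"

definition is_unbounded_topology ::
    "'a::archimedean_vector_lattice set \<Rightarrow> 'a topology \<Rightarrow> 'a topology \<Rightarrow> bool" where
  "is_unbounded_topology S TF T \<longleftrightarrow>
     group_topology T \<and>
     (\<forall>(I :: ('a \<times> 'a set) set) r x. directed_set I r \<longrightarrow>
        (limitin T x 0 (tails I r) \<longleftrightarrow>
         (\<forall>s\<in>S. limitin TF (\<lambda>i. inf \<bar>x i\<bar> \<bar>s\<bar>) 0 (tails I r))))"

text \<open>The topology \<open>u\<^sub>S \<tau>\<^sub>F\<close>; the ideal \<open>F\<close> is the underlying space of \<open>TF\<close>.\<close>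

definition unbounded_topology ::
    "'a::archimedean_vector_lattice set \<Rightarrow> 'a topology \<Rightarrow> 'a topology" where
  "unbounded_topology S TF = (THE T. is_unbounded_topology S TF T)"

lemma is_unbounded_topology_any_net:
  fixes x :: "'i \<Rightarrow> 'a::archimedean_vector_lattice"
  assumes "is_unbounded_topology S TF T" and dir: "directed_set I r"
  shows "limitin T x 0 (tails I r) \<longleftrightarrow>
     (\<forall>s\<in>S. limitin TF (\<lambda>i. inf \<bar>x i\<bar> \<bar>s\<bar>) 0 (tails I r))"
proof -
  obtain J :: "('a \<times> 'a set) set" and q where J: "directed_set J q"
    and eq: "filtermap fst (tails J q) = filtermap x (tails I r)"
    using canonical_net[OF dir] .
  have trJ: "limitin TF (\<lambda>p. inf \<bar>fst p\<bar> \<bar>s\<bar>) 0 (tails J q) \<longleftrightarrow>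
      limitin TF (\<lambda>i. inf \<bar>x i\<bar> \<bar>s\<bar>) 0 (tails I r)" for s
  proof -
    let ?g = "\<lambda>u. inf \<bar>u\<bar> \<bar>s\<bar>"
    have "filtermap ?g (filtermap fst (tails J q)) = filtermap ?g (filtermap x (tails I r))"
      unfolding eq ..
    then show ?thesis
      unfolding limitin_filtermap[of TF "\<lambda>p. inf \<bar>fst p\<bar> \<bar>s\<bar>"]
        limitin_filtermap[of TF "\<lambda>i. inf \<bar>x i\<bar> \<bar>s\<bar>"]
      by (simp add: filtermap_filtermap)
  qed
  have "limitin T fst 0 (tails J q) \<longleftrightarrow>
     (\<forall>s\<in>S. limitin TF (\<lambda>p. inf \<bar>fst p\<bar> \<bar>s\<bar>) 0 (tails J q))"
    using assms(1) J unfolding is_unbounded_topology_def by blast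
  then show ?thesis
    unfolding limitin_filtermap[of T fst] limitin_filtermap[of T x] eq trJ .
qed

end

theory Submission
  imports Defs
begin

text \<open>
  For \<open>\<phi> \<in> A\<close> and \<open>s \<in> S\<close>, the functions \<open>x \<mapsto> \<bar>\<phi>\<bar> (\<bar>x\<bar> \<sqinter> \<bar>s\<bar>)\<close> are monotone and subadditive and, \<open>\<bar>\<phi>\<bar>\<close>
  being order continuous, vanish along uo-null nets; so they generate a uo-Lebesgue topology. It is
  Hausdorff because the ideal generated by \<open>A\<close> separates points and that generated by \<open>S\<close> is order
  dense. Everything else follows from uniqueness of the Hausdorff uo-Lebesgue topology.

  Uniqueness holds in every Archimedean vector lattice and needs neither functionals nor Dedekind
  completeness. Let \<open>T1\<close>, \<open>T2\<close> be two such topologies and suppose that a solid \<open>T2\<close>-neighbourhood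
  \<open>W\<close> of zero contains no \<open>T1\<close>-neighbourhood. Given solid \<open>T1\<close>-neighbourhoods with
  \<open>V (n + 1) + V (n + 1) \<subseteq> V n\<close>, choose positive \<open>x n \<in> V n - W\<close> and let \<open>N\<close> be the ideal
  \<open>\<Inter>n. V n\<close>. Up to a \<open>T2\<close>-small error, \<open>x n = a n + d n\<close> with \<open>d n \<in> N\<close> and \<open>a n\<close> disjoint from
  \<open>N\<close>. The \<open>a n\<close> are uo-null, hence \<open>T2\<close>-null, so some \<open>d n\<close> lies outside a fixed smaller
  neighbourhood \<open>W2\<close>. The elements \<open>d n \<in> N - W2\<close> obtained from all sequences \<open>V\<close> form a net that
  is uo-null because \<open>T1\<close> is Hausdorff, and this contradicts the choice of \<open>W2\<close>.
\<close>

section \<open>Vector lattice preliminaries\<close>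

text \<open>By distributivity the right-hand side is the infimum of \<open>a + b\<close>,
  \<open>a + s\<close>, \<open>s + b\<close> and \<open>s + s\<close>, and each of the last three is
  above \<open>s\<close>.\<close>

lemma inf_add_le_add_inf:
  fixes a b s :: "'a::lattice_ab_group_add"
  assumes "0 \<le> a" "0 \<le> b" "0 \<le> s"
  shows "inf (a + b) s \<le> inf a s + inf b s"
proof -
  have "s \<le> a + s" "s \<le> s + b" "s \<le> s + s"
    using assms by (simp_all add: add_increasing add_increasing2)
  then show ?thesis
    by (simp add: add_inf_distrib_left add_inf_distrib_right le_infI1 le_infI2)
qed

lemma abs_inf_abs [simp]:
  fixes x y :: "'a::lattice_ab_group_add_abs"
  shows "\<bar>inf \<bar>x\<bar> \<bar>y\<bar>\<bar> = inf \<bar>x\<bar> \<bar>y\<bar>"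
  by (simp add: le_infI)

text \<open>The sum of two disjoint elements is their supremum.\<close>

lemma add_le_if_disjoint:
  fixes x y u :: "'a::lattice_ab_group_add"
  assumes "inf x y = 0" "x \<le> u" "y \<le> u"
  shows "x + y \<le> u"
  using add_eq_inf_sup[of x y] assms by simp

text \<open>The inequality \<open>le\<close>, applied to \<open>c *\<^sub>R x\<close> and the
  inverse of \<open>c\<close>, also yields the reverse inequality.\<close>

lemma abs_scaleR_lattice:
  fixes x :: "'a::archimedean_vector_lattice"
  shows "\<bar>c *\<^sub>R x\<bar> = \<bar>c\<bar> *\<^sub>R \<bar>x\<bar>"
proof -
  have le: "\<bar>c *\<^sub>R x\<bar> \<le> \<bar>c\<bar> *\<^sub>R \<bar>x\<bar>" for c and x :: 'a
  proof -
    have "c *\<^sub>R x \<le> \<bar>c\<bar> *\<^sub>R \<bar>x\<bar>" for c and x :: 'a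
    proof (cases "0 \<le> c")
      case True
      then show ?thesis by (simp add: scaleR_left_mono abs_ge_self)
    next
      case False
      then have "(- c) *\<^sub>R (- x) \<le> (- c) *\<^sub>R \<bar>x\<bar>"
        by (intro scaleR_left_mono) (auto simp: abs_ge_minus_self)
      with False show ?thesis by simp
    qed
    from this[of c x] this[of "- c" x] show ?thesis by (intro abs_leI) simp_all
  qed
  show ?thesis
  proof (cases "c = 0")
    case False
    have "\<bar>x\<bar> \<le> \<bar>inverse c\<bar> *\<^sub>R \<bar>c *\<^sub>R x\<bar>"
      using le[of "inverse c" "c *\<^sub>R x"] False by simp
    then have "\<bar>c\<bar> *\<^sub>R \<bar>x\<bar> \<le> \<bar>c\<bar> *\<^sub>R (\<bar>inverse c\<bar> *\<^sub>R \<bar>c *\<^sub>R x\<bar>)"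
      by (rule scaleR_left_mono) simp
    also have "\<dots> = \<bar>c *\<^sub>R x\<bar>" using False by (simp add: abs_inverse)
    finally show ?thesis using le[of c x] by (simp add: antisym)
  qed simp
qed

text \<open>Subtracting \<open>z\<close> from \<open>u0\<close> any number of times stays in
  \<open>U\<close>, hence above \<open>l\<close>, so all multiples of \<open>z\<close> are below
  \<open>u0 - l\<close>. Infima are shown to vanish in this way where the corresponding suprema may
  fail to exist.\<close>

lemma archimedean_descent:
  fixes z :: "'a::archimedean_vector_lattice"
  assumes "u0 \<in> U" "\<And>u. u \<in> U \<Longrightarrow> u - z \<in> U" "\<And>u. u \<in> U \<Longrightarrow> l \<le> u"
  shows "z \<le> 0"
proof (rule archimedean)
  fix n :: nat
  have "u0 - real n *\<^sub>R z \<in> U"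
  proof (induction n)
    case (Suc n)
    from assms(2)[OF this] show ?case by (simp add: algebra_simps)
  qed (use assms(1) in simp)
  then have "l \<le> u0 - real n *\<^sub>R z" by (rule assms(3))
  then show "real n *\<^sub>R z \<le> u0 - l" by (simp add: algebra_simps)
qed

lemma archimedean_inverse:
  fixes z :: "'a::archimedean_vector_lattice"
  assumes "\<And>n. z \<le> inverse (real (Suc n)) *\<^sub>R x"
  shows "z \<le> 0"
proof (rule archimedean)
  fix n :: nat
  have 1: "real (Suc n) *\<^sub>R z \<le> x" for n
    using scaleR_left_mono[OF assms[of n], of "real (Suc n)"] by simp
  \<comment> \<open>The absolute value covers \<open>n = 0\<close>, since no sign of
    \<open>x\<close> is assumed.\<close>
  have 0: "real n *\<^sub>R z \<le> \<bar>x\<bar>" for n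
  proof (cases n)
    case (Suc k)
    then show ?thesis using 1[of k] abs_ge_self[of x] by (metis order_trans)
  qed simp
  then show "real n *\<^sub>R z \<le> \<bar>x\<bar>" .
qed

section \<open>Directed index sets and nets decreasing to zero\<close>

lemma directed_set_nat: "directed_set UNIV {(m, n). m \<le> (n::nat)}"
  unfolding directed_set_def
proof (intro conjI ballI)
  show "preorder_on UNIV {(m, n). m \<le> (n::nat)}"
    by (auto simp: preorder_on_def refl_on_def trans_def)
  show "\<exists>k\<in>UNIV. (m, k) \<in> {(m, n). m \<le> n} \<and> (n, k) \<in> {(m, n). m \<le> n}" for m n :: nat
    by (intro bexI[of _ "max m n"]) auto
qed simp

text \<open>A net decreasing to zero, encoded by the set of its values, which indexes itself under
  the reverse order. Testing positive lower bounds suffices: any other one is replaced by its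
  supremum with \<open>0\<close>.\<close>

definition downward_null :: "'a::archimedean_vector_lattice set \<Rightarrow> bool" where
  "downward_null U \<longleftrightarrow> U \<noteq> {} \<and> (\<forall>a\<in>U. \<forall>b\<in>U. \<exists>c\<in>U. c \<le> a \<and> c \<le> b) \<and>
     (\<forall>u\<in>U. 0 \<le> u) \<and> (\<forall>z\<ge>0. (\<forall>u\<in>U. z \<le> u) \<longrightarrow> z = 0)"

lemma downward_null_decreases:
  assumes "downward_null U"
  shows "decreases_to_zero UNIV U {(u, v). u \<in> U \<and> v \<in> U \<and> v \<le> u} id"
proof -
  have "z \<le> 0" if "\<forall>u\<in>U. z \<le> u" for z
  proof -
    have "sup z 0 = 0" using assms that by (auto simp: downward_null_def)
    then show ?thesis by (metis sup_ge1)
  qed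
  moreover have "directed_set U {(u, v). u \<in> U \<and> v \<in> U \<and> v \<le> u}"
    using assms unfolding directed_set_def downward_null_def
    by (auto simp: preorder_on_def refl_on_def trans_def)
  ultimately show ?thesis
    using assms by (auto simp: decreases_to_zero_def downward_null_def)
qed

lemma uo_convergent_zeroI:
  fixes x :: "'i \<Rightarrow> 'a::archimedean_vector_lattice"
  assumes "\<And>s. 0 \<le> s \<Longrightarrow> \<exists>U. downward_null U \<and>
      (\<forall>u\<in>U. \<exists>a\<in>I. \<forall>c\<in>I. (a, c) \<in> r \<longrightarrow> inf \<bar>x c\<bar> s \<le> u)"
  shows "uo_convergent I r x 0"
  unfolding uo_convergent_def
proof (intro allI impI)
  fix s :: 'a assume s: "0 \<le> s"
  from assms[OF this] obtain U where U: "downward_null U"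
    and dom: "\<forall>u\<in>U. \<exists>a\<in>I. \<forall>c\<in>I. (a, c) \<in> r \<longrightarrow> inf \<bar>x c\<bar> s \<le> u" by blast
  have abs: "\<bar>0 - inf \<bar>x c - 0\<bar> s\<bar> = inf \<bar>x c\<bar> s" for c
    using abs_inf_abs[of "x c" s] s by (simp del: abs_inf_abs diff_inf_eq_sup)
  show "order_convergent UNIV I r (\<lambda>i. inf \<bar>x i - 0\<bar> s) 0"
    by (rule order_convergentI_any_net[OF _ _ downward_null_decreases[OF U]])
      (use dom abs in \<open>auto simp del: diff_inf_eq_sup\<close>)
qed

lemma downward_null_uo_convergent:
  assumes "downward_null U"
  shows "uo_convergent U {(u, v). u \<in> U \<and> v \<in> U \<and> v \<le> u} id 0"
proof (rule uo_convergent_zeroI)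
  fix s :: 'a assume "0 \<le> s"
  have "inf \<bar>c\<bar> s \<le> u" if "u \<in> U" "c \<in> U" "c \<le> u" for u c
    using assms that by (auto simp: downward_null_def intro: le_infI1)
  then show "\<exists>V. downward_null V \<and> (\<forall>u\<in>V. \<exists>a\<in>U. \<forall>c\<in>U.
      (a, c) \<in> {(u, v). u \<in> U \<and> v \<in> U \<and> v \<le> u} \<longrightarrow> inf \<bar>id c\<bar> s \<le> u)"
    using assms by (intro exI[of _ U]) auto
qed

text \<open>Even if \<open>D\<close> has no supremum, the gaps between its upper bounds and its
  members decrease to zero: when \<open>z\<close> is below all gaps, subtracting \<open>z\<close>
  from an upper bound gives an upper bound again, and \<open>archimedean_descent\<close>
  applies.\<close>

lemma upper_bounds_minus_null:
  fixes D :: "'a::archimedean_vector_lattice set"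
  assumes "D \<noteq> {}" and dir: "\<And>a b. a \<in> D \<Longrightarrow> b \<in> D \<Longrightarrow> \<exists>c\<in>D. a \<le> c \<and> b \<le> c"
    and bdd: "\<And>d. d \<in> D \<Longrightarrow> d \<le> s"
  shows "downward_null {u - d | u d. (\<forall>d\<in>D. d \<le> u) \<and> d \<in> D}" (is "downward_null ?U")
  unfolding downward_null_def
proof (intro conjI ballI allI impI)
  show "?U \<noteq> {}" using assms(1) bdd by blast
  show "0 \<le> w" if "w \<in> ?U" for w using that by auto
  show "\<exists>c\<in>?U. c \<le> a \<and> c \<le> b" if "a \<in> ?U" "b \<in> ?U" for a b
  proof -
    from that obtain u d v e where ab: "a = u - d" "\<forall>d\<in>D. d \<le> u" "d \<in> D"
      "b = v - e" "\<forall>d\<in>D. d \<le> v" "e \<in> D" by blast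
    obtain f where f: "f \<in> D" "d \<le> f" "e \<le> f" using dir ab by blast
    have "inf u v - f \<in> ?U" using ab f by (blast intro: le_infI)
    moreover have "inf u v - f \<le> a" "inf u v - f \<le> b"
      using ab f by (auto intro!: diff_mono)
    ultimately show ?thesis by blast
  qed
  fix z :: 'a assume z: "0 \<le> z" "\<forall>w\<in>?U. z \<le> w"
  obtain d0 where d0: "d0 \<in> D" using assms(1) by blast
  have "z \<le> 0"
  proof (rule archimedean_descent)
    show "s \<in> {u. \<forall>d\<in>D. d \<le> u}" using bdd by blast
    show "d0 \<le> u" if "u \<in> {u. \<forall>d\<in>D. d \<le> u}" for u using that d0 by blast
    show "u - z \<in> {u. \<forall>d\<in>D. d \<le> u}" if "u \<in> {u. \<forall>d\<in>D. d \<le> u}" for u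
    proof -
      have "z \<le> u - d" if "d \<in> D" for d
        using z(2) that \<open>u \<in> _\<close> by blast
      then show ?thesis by (simp add: algebra_simps)
    qed
  qed
  with z(1) show "z = 0" by simp
qed


section \<open>Neighbourhoods of zero\<close>

lemma group_topology_translation:
  assumes "group_topology T"
  shows "continuous_map T T (\<lambda>y. x + y)"
proof -
  have "continuous_map T (prod_topology T T) (\<lambda>y. (x, y))"
    using assms by (simp add: continuous_map_pairwise o_def group_topology_def)
  moreover have "continuous_map (prod_topology T T) T (\<lambda>(x, y). x + y)"
    using assms by (simp add: group_topology_def)
  ultimately show ?thesis
    using continuous_map_compose by (fastforce simp: o_def)
qed

text \<open>Translations are continuous with continuous inverses, so the neighbourhoods of zero
  determine the topology.\<close>

lemma group_topology_openin_iff: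
  assumes "group_topology T"
  shows "openin T U \<longleftrightarrow> (\<forall>x\<in>U. \<exists>W. openin T W \<and> 0 \<in> W \<and> (\<forall>v\<in>W. x + v \<in> U))"
proof
  have top: "topspace T = UNIV" using assms by (simp add: group_topology_def)
  note pre = openin_continuous_map_preimage[OF group_topology_translation[OF assms]]
  show "\<forall>x\<in>U. \<exists>W. openin T W \<and> 0 \<in> W \<and> (\<forall>v\<in>W. x + v \<in> U)" if "openin T U"
  proof
    fix x assume "x \<in> U"
    with pre[OF that, of x] show "\<exists>W. openin T W \<and> 0 \<in> W \<and> (\<forall>v\<in>W. x + v \<in> U)"
      by (intro exI[of _ "{y \<in> topspace T. x + y \<in> U}"]) (auto simp: top)
  qed
  assume nbhds: "\<forall>x\<in>U. \<exists>W. openin T W \<and> 0 \<in> W \<and> (\<forall>v\<in>W. x + v \<in> U)"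
  show "openin T U"
  proof (subst openin_subopen, intro ballI)
    fix x assume "x \<in> U"
    with nbhds obtain W where W: "openin T W" "0 \<in> W" "\<forall>v\<in>W. x + v \<in> U" by blast
    have "y \<in> U" if "- x + y \<in> W" for y
      using W(3) that by fastforce
    then show "\<exists>R. openin T R \<and> x \<in> R \<and> R \<subseteq> U"
      using pre[OF W(1), of "- x"] W(2)
      by (intro exI[of _ "{y \<in> topspace T. - x + y \<in> W}"]) (auto simp: top)
  qed
qed

lemma group_topology_eqI:
  assumes "group_topology T" "group_topology T'"
    and "\<And>W. openin T W \<Longrightarrow> 0 \<in> W \<Longrightarrow> \<exists>W'. openin T' W' \<and> 0 \<in> W' \<and> W' \<subseteq> W"
    and "\<And>W. openin T' W \<Longrightarrow> 0 \<in> W \<Longrightarrow> \<exists>W'. openin T W' \<and> 0 \<in> W' \<and> W' \<subseteq> W"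
  shows "T = T'"
proof -
  have "openin S' U" if "group_topology S" "group_topology S'" "openin S U"
    and "\<And>W. openin S W \<Longrightarrow> 0 \<in> W \<Longrightarrow> \<exists>W'. openin S' W' \<and> 0 \<in> W' \<and> W' \<subseteq> W"
    for S S' :: "'a topology" and U
  proof (rule group_topology_openin_iff[OF that(2), THEN iffD2], intro ballI)
    fix x assume "x \<in> U"
    with group_topology_openin_iff[OF that(1), THEN iffD1, OF that(3)]
    obtain W where W: "openin S W" "0 \<in> W" "\<forall>v\<in>W. x + v \<in> U" by auto
    from that(4)[OF W(1,2)] obtain W' where "openin S' W'" "0 \<in> W'" "W' \<subseteq> W" by auto
    with W(3) show "\<exists>W. openin S' W \<and> 0 \<in> W \<and> (\<forall>v\<in>W. x + v \<in> U)" by blast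
  qed
  from this[OF assms(1,2) _ assms(3)] this[OF assms(2,1) _ assms(4)] show ?thesis
    unfolding topology_eq by (intro allI iffI)
qed

lemma locally_solid_imp_group_topology:
  assumes "locally_solid_topology UNIV T"
  shows "group_topology T"
proof -
  have top: "topspace T = UNIV"
    and sc: "continuous_map (prod_topology euclidean T) T (\<lambda>(c::real, x). c *\<^sub>R x)"
    using assms by (auto simp: locally_solid_topology_def)
  have "continuous_map T (prod_topology euclidean T) (\<lambda>y. (- 1 :: real, y))"
    by (simp add: continuous_map_pairwise o_def)
  from continuous_map_compose[OF this sc] have "continuous_map T T uminus"
    by (simp add: o_def)
  with assms top show ?thesis
    by (simp add: group_topology_def locally_solid_topology_def)
qed

section \<open>Solid neighbourhoods of zero\<close>

definition solid_nbhds :: "'a::archimedean_vector_lattice topology \<Rightarrow> 'a set set" where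
  "solid_nbhds T = {V. solid_in UNIV V \<and> (\<exists>W. openin T W \<and> 0 \<in> W \<and> W \<subseteq> V)}"

lemma solid_nbhdsD: "V \<in> solid_nbhds T \<Longrightarrow> y \<in> V \<Longrightarrow> \<bar>x\<bar> \<le> \<bar>y\<bar> \<Longrightarrow> x \<in> V"
  by (auto simp: solid_nbhds_def solid_in_def)

lemma solid_nbhds_le: "V \<in> solid_nbhds T \<Longrightarrow> y \<in> V \<Longrightarrow> 0 \<le> x \<Longrightarrow> x \<le> y \<Longrightarrow> x \<in> V"
  by (erule (1) solid_nbhdsD) (simp add: abs_of_nonneg)

lemma zero_in_solid_nbhds: "V \<in> solid_nbhds T \<Longrightarrow> 0 \<in> V"
  by (auto simp: solid_nbhds_def)

lemma solid_nbhds_Int: "V \<in> solid_nbhds T \<Longrightarrow> W \<in> solid_nbhds T \<Longrightarrow> V \<inter> W \<in> solid_nbhds T"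
proof -
  assume "V \<in> solid_nbhds T" "W \<in> solid_nbhds T"
  moreover from this obtain A B where "openin T A" "0 \<in> A" "A \<subseteq> V" "openin T B" "0 \<in> B" "B \<subseteq> W"
    unfolding solid_nbhds_def by blast
  then have "openin T (A \<inter> B)" "0 \<in> A \<inter> B" "A \<inter> B \<subseteq> V \<inter> W" by auto
  ultimately show ?thesis
    unfolding solid_nbhds_def solid_in_def by blast
qed

lemma solid_nbhds_base:
  assumes "locally_solid_topology UNIV T" "openin T U" "0 \<in> U"
  shows "\<exists>V\<in>solid_nbhds T. V \<subseteq> U"
proof -
  obtain V W where "solid_in UNIV V" "V \<subseteq> U" "openin T W" "0 \<in> W" "W \<subseteq> V"
    using assms(1)[unfolded locally_solid_topology_def] assms(2,3) by metis
  then show ?thesis unfolding solid_nbhds_def by blast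
qed

lemma solid_nbhds_add:
  assumes T: "locally_solid_topology UNIV T" and V: "V \<in> solid_nbhds T"
  shows "\<exists>W\<in>solid_nbhds T. \<forall>a\<in>W. \<forall>b\<in>W. a + b \<in> V"
proof -
  obtain U where U: "openin T U" "0 \<in> U" "U \<subseteq> V" using V by (auto simp: solid_nbhds_def)
  have top: "topspace T = UNIV"
    and "continuous_map (prod_topology T T) T (\<lambda>(x, y). x + y)"
    using T by (auto simp: locally_solid_topology_def)
  from openin_continuous_map_preimage[OF this(2) U(1)]
  have "openin (prod_topology T T) {p. fst p + snd p \<in> U}"
    by (simp add: top case_prod_beta)
  moreover have "(0, 0) \<in> {p. fst p + snd p \<in> U}" using U(2) by simp
  ultimately have "\<exists>A B. openin T A \<and> openin T B \<and> 0 \<in> A \<and> 0 \<in> B \<and>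
      A \<times> B \<subseteq> {p. fst p + snd p \<in> U}"
    by (rule openin_prod_topology_alt[THEN iffD1, rule_format])
  then obtain A B where AB: "openin T A" "openin T B" "0 \<in> A" "0 \<in> B"
    "A \<times> B \<subseteq> {p. fst p + snd p \<in> U}" by auto
  then obtain W where "W \<in> solid_nbhds T" "W \<subseteq> A \<inter> B"
    using solid_nbhds_base[OF T, of "A \<inter> B"] by blast
  with AB(5) U(3) show ?thesis by (intro bexI[of _ W]) fastforce+
qed

lemma UNIV_in_solid_nbhds:
  assumes "locally_solid_topology UNIV T"
  shows "UNIV \<in> solid_nbhds T"
proof -
  have "openin T UNIV"
    using assms openin_topspace[of T] by (simp add: locally_solid_topology_def)
  then show ?thesis unfolding solid_nbhds_def solid_in_def by blast
qed

lemma solid_nbhds_Hausdorff: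
  assumes "locally_solid_topology UNIV T" "Hausdorff_space T"
    and "\<And>V. V \<in> solid_nbhds T \<Longrightarrow> z \<in> V"
  shows "z = 0"
proof (rule ccontr)
  assume "z \<noteq> 0"
  moreover have "topspace T = UNIV" using assms(1) by (simp add: locally_solid_topology_def)
  ultimately obtain U R where "openin T U" "0 \<in> U" "z \<in> R" "disjnt U R"
    using assms(2)[unfolded Hausdorff_space_def, rule_format, of 0 z] by auto
  then have "openin T U" "0 \<in> U" "z \<notin> U" by (auto simp: disjnt_iff)
  then show False using solid_nbhds_base[OF assms(1)] assms(3) by blast
qed

lemma topology_eq_if_solid_nbhds:
  assumes T: "locally_solid_topology UNIV T" and T': "locally_solid_topology UNIV T'"
    and sub: "\<And>W. W \<in> solid_nbhds T \<Longrightarrow> \<exists>V\<in>solid_nbhds T'. V \<subseteq> W"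
      "\<And>W. W \<in> solid_nbhds T' \<Longrightarrow> \<exists>V\<in>solid_nbhds T. V \<subseteq> W"
  shows "T = T'"
proof (rule group_topology_eqI)
  show "group_topology T" "group_topology T'"
    by (rule locally_solid_imp_group_topology, fact)+
next
  fix W assume W: "openin T W" "0 \<in> W"
  obtain V where V: "V \<in> solid_nbhds T" "V \<subseteq> W" using solid_nbhds_base[OF T W] by blast
  obtain V' where "V' \<in> solid_nbhds T'" "V' \<subseteq> V" using sub(1)[OF V(1)] by blast
  with V(2) show "\<exists>W'. openin T' W' \<and> 0 \<in> W' \<and> W' \<subseteq> W" by (auto simp: solid_nbhds_def)
next
  fix W assume W: "openin T' W" "0 \<in> W"
  obtain V where V: "V \<in> solid_nbhds T'" "V \<subseteq> W" using solid_nbhds_base[OF T' W] by blast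
  obtain V' where "V' \<in> solid_nbhds T" "V' \<subseteq> V" using sub(2)[OF V(1)] by blast
  with V(2) show "\<exists>W'. openin T W' \<and> 0 \<in> W' \<and> W' \<subseteq> W" by (auto simp: solid_nbhds_def)
qed


section \<open>Uniqueness of Hausdorff uo-Lebesgue topologies\<close>

lemma uo_Lebesgue_locally_solid: "uo_Lebesgue T \<Longrightarrow> locally_solid_topology UNIV T"
  by (simp add: uo_Lebesgue_def)

lemma uo_Lebesgue_eventually_in:
  assumes "uo_Lebesgue T" "V \<in> solid_nbhds T" "directed_set I r" "uo_convergent I r x 0"
  shows "\<exists>a\<in>I. \<forall>b\<in>I. (a, b) \<in> r \<longrightarrow> x b \<in> V"
proof -
  obtain W where "openin T W" "0 \<in> W" "W \<subseteq> V" using assms(2) by (auto simp: solid_nbhds_def)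
  moreover have "limitin T x 0 (tails I r)"
    by (rule uo_Lebesgue_any_net[OF assms(1,3,4)])
  ultimately have "eventually (\<lambda>i. x i \<in> V) (tails I r)"
    by (auto simp: limitin_def elim!: eventually_mono)
  then show ?thesis by (simp add: eventually_tails[OF assms(3)])
qed

text \<open>The form in which the uo-Lebesgue property is used for monotone nets: \<open>U\<close>,
  indexed by itself, is uo-null and so enters every neighbourhood of zero.\<close>

lemma downward_null_meets_nbhd:
  assumes "uo_Lebesgue T" "V \<in> solid_nbhds T" and U: "downward_null U"
  shows "\<exists>u\<in>U. u \<in> V"
proof -
  let ?r = "{(u, v). u \<in> U \<and> v \<in> U \<and> v \<le> u}"
  have "directed_set U ?r"
    using downward_null_decreases[OF U] by (simp add: decreases_to_zero_def)
  from uo_Lebesgue_eventually_in[OF assms(1,2) this downward_null_uo_convergent[OF U]]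
  show ?thesis by auto
qed

text \<open>A substitute for the supremum of \<open>D\<close>, which may not exist: an upper bound
  that differs from some member of \<open>D\<close> only by an element of \<open>V\<close>.\<close>

lemma upper_bound_in_nbhd:
  assumes "uo_Lebesgue T" "V \<in> solid_nbhds T"
    and "D \<noteq> {}" "\<And>a b. a \<in> D \<Longrightarrow> b \<in> D \<Longrightarrow> \<exists>c\<in>D. a \<le> c \<and> b \<le> c" "\<And>d. d \<in> D \<Longrightarrow> d \<le> s"
  obtains u d where "\<forall>d\<in>D. d \<le> u" "d \<in> D" "u - d \<in> V"
proof -
  obtain w where "w \<in> {u - d | u d. (\<forall>d\<in>D. d \<le> u) \<and> d \<in> D}" "w \<in> V"
    using downward_null_meets_nbhd[OF assms(1,2) upper_bounds_minus_null[OF assms(3-5)]] ..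
  then obtain u d where "\<forall>d\<in>D. d \<le> u" "d \<in> D" "u - d \<in> V" by auto
  then show thesis by (rule that)
qed

section \<open>Sequences of neighbourhoods and the ideals that they cut out\<close>

text \<open>Such a sequence plays the part of a countable base at zero, which \<open>T\<close>
  itself may not have. The halving condition makes the intersection closed under addition and keeps
  tail sums small.\<close>

definition nbhd_sequences ::
    "'a::archimedean_vector_lattice topology \<Rightarrow> (nat \<Rightarrow> 'a set) set" where
  "nbhd_sequences T =
     {V. \<forall>n. V n \<in> solid_nbhds T \<and> (\<forall>a\<in>V (Suc n). \<forall>b\<in>V (Suc n). a + b \<in> V n)}"

lemma nbhd_sequencesD:
  assumes "V \<in> nbhd_sequences T"
  shows "V n \<in> solid_nbhds T"
    and "a \<in> V (Suc n) \<Longrightarrow> b \<in> V (Suc n) \<Longrightarrow> a + b \<in> V n"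
  using assms by (simp_all add: nbhd_sequences_def)

lemma nbhd_sequence_through:
  assumes T: "locally_solid_topology UNIV T" and "V \<in> solid_nbhds T"
  obtains S where "S \<in> nbhd_sequences T" "S 0 = V"
proof -
  \<comment> \<open>The clause for \<open>n = 0\<close> prescribes the first member, which
    \<open>dependent_nat_choice\<close> otherwise leaves open.\<close>
  have "\<exists>S. \<forall>n. (S n \<in> solid_nbhds T \<and> (n = 0 \<longrightarrow> S n = V)) \<and>
      (\<forall>a\<in>S (Suc n). \<forall>b\<in>S (Suc n). a + b \<in> S n)"
  proof (rule dependent_nat_choice)
    show "\<exists>A. A \<in> solid_nbhds T \<and> (0 = (0::nat) \<longrightarrow> A = V)" using assms(2) by simp
    fix A and n :: nat assume "A \<in> solid_nbhds T \<and> (n = 0 \<longrightarrow> A = V)"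
    then obtain B where "B \<in> solid_nbhds T" "\<forall>a\<in>B. \<forall>b\<in>B. a + b \<in> A"
      using solid_nbhds_add[OF T, of A] by auto
    then show "\<exists>B. (B \<in> solid_nbhds T \<and> (Suc n = 0 \<longrightarrow> B = V)) \<and>
        (\<forall>a\<in>B. \<forall>b\<in>B. a + b \<in> A)" by auto
  qed
  then obtain S where "S \<in> nbhd_sequences T" "S 0 = V"
    unfolding nbhd_sequences_def by fast
  then show thesis by (rule that)
qed

lemma nbhd_sequences_Int:
  assumes "V \<in> nbhd_sequences T" "W \<in> nbhd_sequences T"
  shows "(\<lambda>n. V n \<inter> W n) \<in> nbhd_sequences T"
  using assms by (simp add: nbhd_sequences_def solid_nbhds_Int)

lemma nbhd_sequences_Inter_add:
  assumes "V \<in> nbhd_sequences T" "a \<in> (\<Inter>n. V n)" "b \<in> (\<Inter>n. V n)"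
  shows "a + b \<in> (\<Inter>n. V n)"
proof
  fix n
  show "a + b \<in> V n" by (rule nbhd_sequencesD(2)[OF assms(1)]) (use assms(2,3) in auto)
qed

lemma nbhd_sequences_Inter_le:
  assumes "V \<in> nbhd_sequences T" "b \<in> (\<Inter>n. V n)" "0 \<le> a" "a \<le> b"
  shows "a \<in> (\<Inter>n. V n)"
proof
  fix n
  show "a \<in> V n"
    by (rule solid_nbhds_le[OF nbhd_sequencesD(1)[OF assms(1)], of b]) (use assms(2-4) in auto)
qed

text \<open>The sum starts after \<open>n\<close>, so its first term and, by the induction
  hypothesis at \<open>Suc n\<close>, the remaining sum both lie in \<open>V (Suc n)\<close>;
  together they lie in \<open>V n\<close>.\<close>

lemma nbhd_sequences_sum:
  assumes V: "V \<in> nbhd_sequences T" and "\<And>n. a n \<in> V n"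
  shows "(\<Sum>k\<in>{n<..n + m}. a k) \<in> V n"
proof (induction m arbitrary: n)
  case 0
  then show ?case using zero_in_solid_nbhds nbhd_sequencesD(1)[OF V] by auto
next
  case (Suc m)
  have "{n<..n + Suc m} = insert (Suc n) {Suc n<..Suc n + m}" by auto
  then have "(\<Sum>k\<in>{n<..n + Suc m}. a k) = a (Suc n) + (\<Sum>k\<in>{Suc n<..Suc n + m}. a k)"
    by simp
  then show ?case using nbhd_sequencesD(2)[OF V assms(2) Suc.IH] by simp
qed

text \<open>
  With \<open>N = (\<Inter>n. V n)\<close>, the limes superior of \<open>a\<close> below any bound \<open>s\<close> lies in \<open>N\<close>, because the
  \<open>V n\<close> make the sequence summable; being disjoint from \<open>N\<close>, it vanishes.
\<close>

lemma uo_null_if_disjoint_from_Inter: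
  assumes T: "uo_Lebesgue T" and V: "V \<in> nbhd_sequences T"
    and a: "\<And>n. a n \<in> V n" "\<And>n. 0 \<le> a n"
    and dis: "\<And>n z. z \<in> (\<Inter>n. V n) \<Longrightarrow> 0 \<le> z \<Longrightarrow> z \<le> a n \<Longrightarrow> z = 0"
  shows "uo_convergent UNIV {(m, n). m \<le> n} a 0"
proof (rule uo_convergent_zeroI)
  fix s :: 'a assume s: "0 \<le> s"
  \<comment> \<open>These are the eventual upper bounds; their infimum, if it existed, would be the
    limes superior of \<open>inf (a m) s\<close>.\<close>
  define U where "U = {u. \<exists>n. \<forall>m\<ge>n. inf (a m) s \<le> u}"
  have pos: "0 \<le> u" if "u \<in> U" for u
  proof -
    from that obtain n where "inf (a n) s \<le> u" unfolding U_def by blast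
    moreover have "0 \<le> inf (a n) s" using a(2) s by simp
    ultimately show ?thesis by (rule order_trans[rotated])
  qed
  have "s \<in> U" by (simp add: U_def)
  have "downward_null U"
    unfolding downward_null_def
  proof (intro conjI ballI allI impI)
    show "U \<noteq> {}" using \<open>s \<in> U\<close> by blast
    show "\<exists>w\<in>U. w \<le> u \<and> w \<le> v" if "u \<in> U" "v \<in> U" for u v
    proof -
      from that obtain n n' where "\<forall>m\<ge>n. inf (a m) s \<le> u" "\<forall>m\<ge>n'. inf (a m) s \<le> v"
        unfolding U_def by blast
      then have "\<forall>m\<ge>max n n'. inf (a m) s \<le> inf u v" by simp
      then have "inf u v \<in> U" unfolding U_def by blast
      then show ?thesis by (intro bexI[of _ "inf u v"]) simp_all
    qed
    fix z :: 'a assume z: "0 \<le> z" "\<forall>u\<in>U. z \<le> u"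
    \<comment> \<open>By solidity it is enough to find one element of \<open>U\<close> that lies in
      \<open>V j\<close>.\<close>
    have "z \<in> V j" for j
    proof -
      \<comment> \<open>All members of \<open>D\<close> lie in \<open>V (Suc j)\<close>, and every
        \<open>inf (a m) s\<close> with \<open>m > Suc j\<close> is a member. An upper bound
        \<open>u\<close> of \<open>D\<close> is therefore in \<open>U\<close>; if it is chosen close
        to some \<open>d\<close> in \<open>D\<close>, then \<open>u = (u - d) + d\<close> is in
        \<open>V j\<close>.\<close>
      define D where "D = {d. 0 \<le> d \<and> d \<le> s \<and> (\<exists>m. d \<le> (\<Sum>k\<in>{Suc j<..Suc j + m}. a k))}"
      have inD: "inf (a m) s \<in> D" if "m > Suc j" for m
      proof -
        have "a m \<le> (\<Sum>k\<in>{Suc j<..Suc j + m}. a k)"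
          using that sum_mono2[of "{Suc j<..Suc j + m}" "{m}" a] a(2) by simp
        then show ?thesis using a(2) s unfolding D_def by (auto intro: le_infI1)
      qed
      have DV: "d \<in> V (Suc j)" if d: "d \<in> D" for d
      proof -
        from d obtain m where "0 \<le> d" "d \<le> (\<Sum>k\<in>{Suc j<..Suc j + m}. a k)"
          by (auto simp: D_def)
        then show ?thesis
          by (rule solid_nbhds_le[OF nbhd_sequencesD(1)[OF V] nbhd_sequences_sum[OF V a(1)]])
      qed
      obtain u d where ud: "\<forall>d\<in>D. d \<le> u" "d \<in> D" "u - d \<in> V (Suc j)"
      proof (rule upper_bound_in_nbhd[OF T nbhd_sequencesD(1)[OF V, of "Suc j"], of D])
        show "D \<noteq> {}" using inD by blast
        show "d \<le> s" if "d \<in> D" for d using that by (simp add: D_def)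
        show "\<exists>f\<in>D. d \<le> f \<and> e \<le> f" if "d \<in> D" "e \<in> D" for d e
        proof -
          from that obtain m m' where m: "d \<le> (\<Sum>k\<in>{Suc j<..Suc j + m}. a k)"
            "e \<le> (\<Sum>k\<in>{Suc j<..Suc j + m'}. a k)" by (auto simp: D_def)
          have "(\<Sum>k\<in>{Suc j<..Suc j + m}. a k) \<le> (\<Sum>k\<in>{Suc j<..Suc j + max m m'}. a k)"
            "(\<Sum>k\<in>{Suc j<..Suc j + m'}. a k) \<le> (\<Sum>k\<in>{Suc j<..Suc j + max m m'}. a k)"
            by (intro sum_mono2; auto simp: a(2))+
          with m have "sup d e \<le> (\<Sum>k\<in>{Suc j<..Suc j + max m m'}. a k)"
            by (intro le_supI) (rule order_trans, assumption+)+
          moreover have "0 \<le> sup d e" "sup d e \<le> s"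
            using that by (auto simp: D_def intro: le_supI1)
          ultimately have "sup d e \<in> D" unfolding D_def by blast
          then show ?thesis by (intro bexI[of _ "sup d e"]) simp_all
        qed
      qed
      have "\<forall>m\<ge>Suc (Suc j). inf (a m) s \<le> u" using ud(1) inD by simp
      then have "u \<in> U" unfolding U_def by blast
      moreover have "u \<in> V j" using nbhd_sequencesD(2)[OF V ud(3) DV[OF ud(2)]] by simp
      moreover have "z \<le> u" using z(2) \<open>u \<in> U\<close> by blast
      ultimately show ?thesis by (intro solid_nbhds_le[OF nbhd_sequencesD(1)[OF V] _ z(1)])
    qed
    then have N: "z \<in> (\<Inter>n. V n)" by (rule INT_I)
    \<comment> \<open>The infimum of \<open>inf (a m) s\<close> and \<open>z\<close> lies in the
      ideal and below \<open>a m\<close>, so it is zero. As both elements are below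
      \<open>u\<close>, so is their sum.\<close>
    have "u - z \<in> U" if "u \<in> U" for u
    proof -
      from that obtain n where n: "\<forall>m\<ge>n. inf (a m) s \<le> u" by (auto simp: U_def)
      have "inf (a m) s \<le> u - z" if "m \<ge> n" for m
      proof -
        have "inf (inf (a m) s) z = 0"
        proof (rule dis)
          show pos: "0 \<le> inf (inf (a m) s) z" using a(2) s z(1) by simp
          show "inf (inf (a m) s) z \<in> (\<Inter>n. V n)"
            by (rule nbhd_sequences_Inter_le[OF V N pos]) simp
          show "inf (inf (a m) s) z \<le> a m" by (simp add: le_infI1)
        qed
        then have "inf (a m) s + z \<le> u"
          using n that z(2) \<open>u \<in> U\<close> by (intro add_le_if_disjoint) auto
        then show ?thesis by (simp add: algebra_simps)
      qed
      then show ?thesis unfolding U_def by blast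
    qed
    then have "z \<le> 0" by (rule archimedean_descent[OF \<open>s \<in> U\<close> _ pos])
    with z(1) show "z = 0" by simp
  qed (rule pos)
  moreover have "\<forall>u\<in>U. \<exists>n\<in>UNIV. \<forall>m\<in>UNIV. (n, m) \<in> {(m, n). m \<le> n} \<longrightarrow> inf \<bar>a m\<bar> s \<le> u"
    by (auto simp: U_def abs_of_nonneg[OF a(2)])
  ultimately show "\<exists>U. downward_null U \<and> (\<forall>u\<in>U. \<exists>n\<in>UNIV. \<forall>m\<in>UNIV.
      (n, m) \<in> {(m, n). m \<le> n} \<longrightarrow> inf \<bar>a m\<bar> s \<le> u)" by blast
qed

text \<open>This replaces the projection of \<open>x\<close> onto the band generated by
  \<open>N\<close>, which may not exist. The role of the supremum of the part \<open>D\<close> of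
  \<open>N\<close> below \<open>x\<close> is taken by an upper bound \<open>u\<close> of
  \<open>D\<close> that is close to some \<open>d\<close> in \<open>D\<close>. The error
  \<open>x - a - d\<close> is \<open>inf u x - d\<close>, which is below \<open>u - d\<close>;
  disjointness of \<open>a\<close> from \<open>N\<close> is exact.\<close>

lemma approximate_band_decomposition:
  assumes T: "uo_Lebesgue T" and W: "W \<in> solid_nbhds T" and x: "0 \<le> x"
    and N: "0 \<in> N" "\<And>a b. a \<in> N \<Longrightarrow> b \<in> N \<Longrightarrow> a + b \<in> N"
      "\<And>a b. b \<in> N \<Longrightarrow> 0 \<le> a \<Longrightarrow> a \<le> b \<Longrightarrow> a \<in> N"
  obtains a d where "0 \<le> a" "a \<le> x" "d \<in> N" "0 \<le> d" "x - a - d \<in> W"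
    "\<And>z. z \<in> N \<Longrightarrow> 0 \<le> z \<Longrightarrow> z \<le> a \<Longrightarrow> z = 0"
proof -
  define D where "D = {d \<in> N. 0 \<le> d \<and> d \<le> x}"
  have "0 \<in> D" using N(1) x by (simp add: D_def)
  obtain u d where ud: "\<forall>d\<in>D. d \<le> u" "d \<in> D" "u - d \<in> W"
  proof (rule upper_bound_in_nbhd[OF T W, of D x])
    show "D \<noteq> {}" using \<open>0 \<in> D\<close> by blast
    show "\<exists>c\<in>D. a \<le> c \<and> b \<le> c" if "a \<in> D" "b \<in> D" for a b
    proof -
      have "sup a b \<le> a + b" using that by (simp add: D_def add_increasing add_increasing2)
      with that have "sup a b \<in> D"
        using N(3)[OF N(2), of a b "sup a b"] unfolding D_def by (auto intro: le_supI1)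
      then show ?thesis by (intro bexI[of _ "sup a b"]) simp_all
    qed
  qed (auto simp: D_def)
  define a where "a = x - inf u x"
  show thesis
  proof (rule that[of a d])
    have "0 \<le> inf u x" using ud(1) \<open>0 \<in> D\<close> x by auto
    then show "a \<le> x" unfolding a_def by (simp del: diff_inf_eq_sup)
    show "0 \<le> a" unfolding a_def by (simp del: diff_inf_eq_sup)
    show "d \<in> N" "0 \<le> d" using ud(2) by (auto simp: D_def)
    have "d \<le> inf u x" using ud by (auto simp: D_def)
    then have "inf u x - d \<in> W"
      by (intro solid_nbhds_le[OF W ud(3)]) (simp_all add: diff_right_mono)
    then show "x - a - d \<in> W" unfolding a_def by (simp del: diff_inf_eq_sup)
    fix z assume z: "z \<in> N" "0 \<le> z" "z \<le> a"
    have "z \<le> 0"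
    \<comment> \<open>As \<open>z\<close> is below \<open>x - inf u x\<close>, adding it to a member
      of \<open>D\<close> gives a member of \<open>D\<close> again.\<close>
    proof (rule archimedean_descent)
      show "x \<in> {x - d | d. d \<in> D}" using \<open>0 \<in> D\<close> by force
      show "0 \<le> w" if "w \<in> {x - d | d. d \<in> D}" for w using that by (auto simp: D_def)
      show "w - z \<in> {x - d | d. d \<in> D}" if w: "w \<in> {x - d | d. d \<in> D}" for w
      proof -
        from w obtain e where e: "w = x - e" "e \<in> D" by blast
        have "e \<le> inf u x" using e(2) ud(1) by (auto simp: D_def)
        from add_mono[OF this z(3)] have "e + z \<le> x"
          unfolding a_def by (simp del: diff_inf_eq_sup)
        moreover have "e + z \<in> N" "0 \<le> e + z" using e(2) z N(2) by (auto simp: D_def)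
        ultimately have "e + z \<in> D" by (simp add: D_def)
        then show ?thesis using e(1) by (force simp: algebra_simps)
      qed
    qed
    with z(2) show "z = 0" by simp
  qed
qed

text \<open>Each \<open>x n\<close> outside \<open>W\<close> has three parts: \<open>a n\<close>
  disjoint from the ideal, \<open>d n\<close> in the ideal, and an error in \<open>W2\<close>.
  Halving \<open>W\<close> twice makes room for them: once \<open>a n\<close> has entered
  \<open>W1\<close>, having \<open>d n\<close> in \<open>W2\<close> would put \<open>x n\<close>
  into \<open>W\<close>.\<close>

lemma escape_in_Inter:
  assumes T1: "uo_Lebesgue T1" and T2: "uo_Lebesgue T2" and W: "W \<in> solid_nbhds T2"
    "W1 \<in> solid_nbhds T2" "\<forall>a\<in>W1. \<forall>b\<in>W1. a + b \<in> W"
    "W2 \<in> solid_nbhds T2" "\<forall>a\<in>W2. \<forall>b\<in>W2. a + b \<in> W1"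
    and notin: "\<And>V. V \<in> solid_nbhds T1 \<Longrightarrow> \<not> V \<subseteq> W" and V: "V \<in> nbhd_sequences T1"
  obtains z where "0 \<le> z" "z \<in> (\<Inter>n. V n)" "z \<notin> W2"
proof -
  have "\<exists>x. 0 \<le> x \<and> x \<in> V n \<and> x \<notin> W" for n
  proof -
    obtain y where "y \<in> V n" "y \<notin> W" using notin nbhd_sequencesD(1)[OF V] by blast
    then have "\<bar>y\<bar> \<in> V n" "\<bar>y\<bar> \<notin> W"
      using solid_nbhdsD[OF nbhd_sequencesD(1)[OF V]] solid_nbhdsD[OF W(1)] by force+
    then show ?thesis by (intro exI[of _ "\<bar>y\<bar>"]) simp
  qed
  then obtain x where x: "\<And>n. 0 \<le> x n" "\<And>n. x n \<in> V n" "\<And>n. x n \<notin> W" by metis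
  let ?N = "\<Inter>n. V n"
  have "\<exists>a d. 0 \<le> a \<and> a \<le> x n \<and> d \<in> ?N \<and> 0 \<le> d \<and> x n - a - d \<in> W2 \<and>
      (\<forall>z\<in>?N. 0 \<le> z \<longrightarrow> z \<le> a \<longrightarrow> z = 0)" for n
  proof (rule approximate_band_decomposition[OF T2 W(4) x(1)[of n], of ?N])
    show "0 \<in> ?N" using zero_in_solid_nbhds[OF nbhd_sequencesD(1)[OF V]] by simp
    show "a + b \<in> ?N" if "a \<in> ?N" "b \<in> ?N" for a b
      by (rule nbhd_sequences_Inter_add[OF V that])
    show "a \<in> ?N" if "b \<in> ?N" "0 \<le> a" "a \<le> b" for a b
      by (rule nbhd_sequences_Inter_le[OF V that])
  qed (blast intro: that)
  then obtain a d where ad: "\<And>n. 0 \<le> a n" "\<And>n. a n \<le> x n" "\<And>n. d n \<in> ?N" "\<And>n. 0 \<le> d n"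
    "\<And>n. x n - a n - d n \<in> W2" "\<And>n z. z \<in> ?N \<Longrightarrow> 0 \<le> z \<Longrightarrow> z \<le> a n \<Longrightarrow> z = 0" by metis
  have "a n \<in> V n" for n
    using solid_nbhds_le[OF nbhd_sequencesD(1)[OF V] x(2) ad(1,2)] .
  then have "uo_convergent UNIV {(m, n). m \<le> n} a 0"
    by (rule uo_null_if_disjoint_from_Inter[OF T1 V _ ad(1) ad(6)])
  from uo_Lebesgue_eventually_in[OF T2 W(2) directed_set_nat this]
  obtain n where n: "a n \<in> W1" by auto
  have "d n \<notin> W2"
  proof
    assume "d n \<in> W2"
    with W(5) ad(5) have "(x n - a n - d n) + d n \<in> W1" by blast
    with W(3) n have "a n + ((x n - a n - d n) + d n) \<in> W" by blast
    then show False using x(3) by simp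
  qed
  with ad(3,4) show thesis by (intro that)
qed

lemma uo_Lebesgue_nbhd_subset:
  assumes T1: "uo_Lebesgue T1" "Hausdorff_space T1" and T2: "uo_Lebesgue T2"
    and W: "W \<in> solid_nbhds T2"
  shows "\<exists>V\<in>solid_nbhds T1. V \<subseteq> W"
proof (rule ccontr)
  note LS1 = uo_Lebesgue_locally_solid[OF T1(1)] and LS2 = uo_Lebesgue_locally_solid[OF T2]
  assume notin: "\<not> (\<exists>V\<in>solid_nbhds T1. V \<subseteq> W)"
  obtain W1 where W1: "W1 \<in> solid_nbhds T2" "\<forall>a\<in>W1. \<forall>b\<in>W1. a + b \<in> W"
    using solid_nbhds_add[OF LS2 W] by blast
  obtain W2 where W2: "W2 \<in> solid_nbhds T2" "\<forall>a\<in>W2. \<forall>b\<in>W2. a + b \<in> W1"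
    using solid_nbhds_add[OF LS2 W1(1)] by blast
  define J where "J = nbhd_sequences T1"
  \<comment> \<open>Later sequences are termwise smaller, so the ideals that they cut out decrease
    along the net.\<close>
  define r where "r = {(V, V'). V \<in> J \<and> V' \<in> J \<and> (\<forall>n. V' n \<subseteq> V n)}"
  have "\<exists>z. 0 \<le> z \<and> z \<in> (\<Inter>n. V n) \<and> z \<notin> W2" if "V \<in> J" for V
  proof (rule escape_in_Inter[OF T1(1) T2 W W1 W2])
    show "V \<in> nbhd_sequences T1" using that by (simp add: J_def)
    show "\<not> V \<subseteq> W" if "V \<in> solid_nbhds T1" for V using notin that by blast
  qed (intro exI conjI)
  then obtain z where z: "\<And>V. V \<in> J \<Longrightarrow> 0 \<le> z V" "\<And>V. V \<in> J \<Longrightarrow> z V \<in> (\<Inter>n. V n)"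
    "\<And>V. V \<in> J \<Longrightarrow> z V \<notin> W2" by metis
  obtain V0 where "V0 \<in> J"
    using nbhd_sequence_through[OF LS1 UNIV_in_solid_nbhds[OF LS1]] unfolding J_def by blast
  have zero: "0 \<in> V n" if "V \<in> J" for V n
    using zero_in_solid_nbhds[OF nbhd_sequencesD(1)] that unfolding J_def by blast
  have dir: "directed_set J r"
    unfolding directed_set_def
  proof (intro conjI ballI)
    show "J \<noteq> {}" using \<open>V0 \<in> J\<close> by blast
    show "preorder_on J r"
      unfolding preorder_on_def r_def refl_on_def trans_def by (auto 4 3)
    show "\<exists>S\<in>J. (V, S) \<in> r \<and> (V', S) \<in> r" if "V \<in> J" "V' \<in> J" for V V'
      using that nbhd_sequences_Int unfolding J_def r_def
      by (intro bexI[of _ "\<lambda>n. V n \<inter> V' n"]) auto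
  qed
  have "uo_convergent J r z 0"
  proof (rule uo_convergent_zeroI)
    fix s :: 'a assume s: "0 \<le> s"
    \<comment> \<open>For \<open>V'\<close> after \<open>V\<close>, the element
      \<open>inf (z V') s\<close> lies in the ideal cut out by \<open>V\<close> and below
      \<open>s\<close>, so each \<open>u\<close> in \<open>U\<close> bounds a tail of the
      net.\<close>
    define U where "U = {u. \<exists>V\<in>J. \<forall>y\<in>(\<Inter>n. V n). 0 \<le> y \<longrightarrow> y \<le> s \<longrightarrow> y \<le> u}"
    have pos: "0 \<le> u" if "u \<in> U" for u
      using that s zero unfolding U_def by blast
    have "downward_null U"
      unfolding downward_null_def
    proof (intro conjI ballI allI impI)
      show "U \<noteq> {}" using \<open>V0 \<in> J\<close> unfolding U_def by blast
      show "\<exists>w\<in>U. w \<le> u \<and> w \<le> v" if "u \<in> U" "v \<in> U" for u v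
      proof -
        from that obtain V V' where V: "V \<in> J" "V' \<in> J"
          "\<forall>y\<in>(\<Inter>n. V n). 0 \<le> y \<longrightarrow> y \<le> s \<longrightarrow> y \<le> u"
          "\<forall>y\<in>(\<Inter>n. V' n). 0 \<le> y \<longrightarrow> y \<le> s \<longrightarrow> y \<le> v" unfolding U_def by blast
        then have "(\<lambda>n. V n \<inter> V' n) \<in> J"
          "\<forall>y\<in>(\<Inter>n. V n \<inter> V' n). 0 \<le> y \<longrightarrow> y \<le> s \<longrightarrow> y \<le> inf u v"
          by (auto simp: J_def intro: nbhd_sequences_Int)
        then have "inf u v \<in> U" unfolding U_def by blast
        then show ?thesis by (intro bexI[of _ "inf u v"]) simp_all
      qed
      fix w :: 'a assume w: "0 \<le> w" "\<forall>u\<in>U. w \<le> u"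
      show "w = 0"
      \<comment> \<open>It suffices that \<open>w\<close> lies in every solid neighbourhood
        \<open>R\<close>. A sequence \<open>V\<close> starting with \<open>R\<close> gives some
        \<open>u\<close> in \<open>U\<close> that differs from an element \<open>d\<close> of
        \<open>V (Suc 0)\<close> by an element of \<open>V (Suc 0)\<close>. Hence \<open>u\<close>
        is in \<open>R\<close>, and so is \<open>w\<close>, being below \<open>u\<close>.\<close>
      proof (rule solid_nbhds_Hausdorff[OF LS1 T1(2)])
        fix R assume "R \<in> solid_nbhds T1"
        then obtain V where V: "V \<in> nbhd_sequences T1" "V 0 = R"
          using nbhd_sequence_through[OF LS1] by blast
        define D where "D = {y \<in> (\<Inter>n. V n). 0 \<le> y \<and> y \<le> s}"
        obtain u d where ud: "\<forall>d\<in>D. d \<le> u" "d \<in> D" "u - d \<in> V (Suc 0)"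
        proof (rule upper_bound_in_nbhd[OF T1(1) nbhd_sequencesD(1)[OF V(1), of "Suc 0"], of D])
          show "D \<noteq> {}" using zero V(1) s unfolding D_def J_def by blast
          show "d \<le> s" if "d \<in> D" for d using that by (simp add: D_def)
          show "\<exists>c\<in>D. a \<le> c \<and> b \<le> c" if "a \<in> D" "b \<in> D" for a b
          proof -
            have "sup a b \<le> a + b" using that by (simp add: D_def add_increasing add_increasing2)
            with that have "sup a b \<in> D"
              using nbhd_sequences_Inter_le[OF V(1) nbhd_sequences_Inter_add[OF V(1)], of a b "sup a b"]
              unfolding D_def by (auto intro: le_supI1)
            then show ?thesis by (intro bexI[of _ "sup a b"]) simp_all
          qed
        qed
        have "u \<in> U" using ud(1) V(1) unfolding U_def D_def J_def by blast
        moreover have "d \<in> V (Suc 0)" using ud(2) by (auto simp: D_def)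
        from nbhd_sequencesD(2)[OF V(1) ud(3) this] have "u \<in> R" using V(2) by simp
        moreover have "w \<le> u" using w(2) \<open>u \<in> U\<close> by blast
        ultimately show "w \<in> R" by (intro solid_nbhds_le[OF \<open>R \<in> solid_nbhds T1\<close> _ w(1)])
      qed
    qed (use pos in blast)
    moreover have "\<exists>V\<in>J. \<forall>V'\<in>J. (V, V') \<in> r \<longrightarrow> inf \<bar>z V'\<bar> s \<le> u" if "u \<in> U" for u
    proof -
      from that obtain V where V: "V \<in> J" "\<forall>y\<in>(\<Inter>n. V n). 0 \<le> y \<longrightarrow> y \<le> s \<longrightarrow> y \<le> u"
        unfolding U_def by blast
      have "inf \<bar>z V'\<bar> s \<le> u" if V': "V' \<in> J" "(V, V') \<in> r" for V'
      proof -
        have "inf (z V') s \<in> (\<Inter>n. V' n)"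
          using nbhd_sequences_Inter_le[OF _ z(2)[OF V'(1)]] V'(1) z(1)[OF V'(1)] s
          unfolding J_def by (metis inf_le1 le_inf_iff)
        then have "inf (z V') s \<in> (\<Inter>n. V n)" using V'(2) by (auto simp: r_def)
        then show ?thesis using V(2) z(1)[OF V'(1)] s by (simp add: abs_of_nonneg)
      qed
      with V(1) show ?thesis by blast
    qed
    ultimately show "\<exists>U. downward_null U \<and>
        (\<forall>u\<in>U. \<exists>V\<in>J. \<forall>V'\<in>J. (V, V') \<in> r \<longrightarrow> inf \<bar>z V'\<bar> s \<le> u)" by blast
  qed
  from uo_Lebesgue_eventually_in[OF T2 W2(1) dir this] z(3) dir show False
    unfolding directed_set_def by blast
qed

lemma uo_Lebesgue_unique:
  assumes "uo_Lebesgue T1" "Hausdorff_space T1" "uo_Lebesgue T2" "Hausdorff_space T2"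
  shows "T1 = T2"
  using assms by (intro topology_eq_if_solid_nbhds uo_Lebesgue_locally_solid uo_Lebesgue_nbhd_subset)


section \<open>The modulus of an order continuous functional\<close>

lemma lattice_idealD:
  assumes "lattice_ideal F"
  shows "subspace F" "y \<in> F \<Longrightarrow> \<bar>x\<bar> \<le> \<bar>y\<bar> \<Longrightarrow> x \<in> F"
  using assms unfolding lattice_ideal_def solid_in_def by blast+

lemma lattice_ideal_le:
  assumes "lattice_ideal F" "y \<in> F" "\<bar>x\<bar> \<le> y"
  shows "x \<in> F"
proof (rule lattice_idealD(2)[OF assms(1,2)])
  show "\<bar>x\<bar> \<le> \<bar>y\<bar>" using assms(3) abs_ge_self[of y] by (rule order_trans)
qed

lemma functional_onD:
  assumes "functional_on F \<phi>"
  shows "x \<in> F \<Longrightarrow> y \<in> F \<Longrightarrow> \<phi> (x + y) = \<phi> x + \<phi> y" "x \<in> F \<Longrightarrow> \<phi> (c *\<^sub>R x) = c * \<phi> x"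
    "x \<notin> F \<Longrightarrow> \<phi> x = 0"
  using assms unfolding functional_on_def by blast+

lemma functional_on_minus:
  assumes "functional_on F \<phi>" "x \<in> F"
  shows "\<phi> (- x) = - \<phi> x"
  using functional_onD(2)[OF assms, of "- 1"] by simp

lemma functional_on_diff:
  assumes "functional_on F \<phi>" "subspace F" "x \<in> F" "y \<in> F"
  shows "\<phi> (x - y) = \<phi> x - \<phi> y"
  using functional_onD(1)[OF assms(1,3), of "- y"] functional_on_minus[OF assms(1,4)] assms(2,4)
  by (simp add: subspace_neg)

text \<open>If \<open>0 \<notin> F\<close>, the value is zero by the convention for
  functionals.\<close>

lemma functional_on_zero:
  assumes "functional_on F \<phi>"
  shows "\<phi> 0 = 0"
  using functional_onD(2)[OF assms, of 0 0] functional_onD(3)[OF assms, of 0] by fastforce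

lemma decreases_to_zero_inverse:
  fixes u :: "'a::archimedean_vector_lattice"
  assumes "subspace F" "u \<in> F" "0 \<le> u"
  shows "decreases_to_zero F UNIV {(m, n). m \<le> n} (\<lambda>n. inverse (real (Suc n)) *\<^sub>R u)"
  unfolding decreases_to_zero_def
proof (intro conjI ballI impI)
  show "directed_set UNIV {(m, n). m \<le> (n::nat)}" by (rule directed_set_nat)
  show "range (\<lambda>n. inverse (real (Suc n)) *\<^sub>R u) \<subseteq> F"
    using assms by (auto intro: subspace_scale)
  show "inverse (real (Suc n)) *\<^sub>R u \<le> inverse (real (Suc m)) *\<^sub>R u"
    if "(m, n) \<in> {(m, n). m \<le> n}" for m n
    using that assms(3) by (intro scaleR_right_mono le_imp_inverse_le) auto
  show "0 \<le> inverse (real (Suc n)) *\<^sub>R u" for n using assms(3) by (simp add: scaleR_nonneg_nonneg)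
  show "z \<le> 0" if "\<forall>n\<in>UNIV. z \<le> inverse (real (Suc n)) *\<^sub>R u" for z
    by (rule archimedean_inverse[of z u]) (use that in blast)
qed

text \<open>
  The preorder on pairs \<open>(n, y)\<close> ignores \<open>y\<close>, so that convergence of the net of all \<open>\<phi> (y / n)\<close>
  is uniform in \<open>y\<close>.
\<close>

lemma oc_dual_bounded:
  fixes F :: "'a::archimedean_vector_lattice set"
  assumes F: "lattice_ideal F" and \<phi>: "\<phi> \<in> oc_dual F" and u: "u \<in> F" "0 \<le> u"
  shows "\<exists>M. \<forall>y. \<bar>y\<bar> \<le> u \<longrightarrow> \<bar>\<phi> y\<bar> \<le> M"
proof -
  have lin: "functional_on F \<phi>" using \<phi> by (simp add: oc_dual_def)
  define I where "I = {(n::nat, y). \<bar>y\<bar> \<le> u}"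
  define r where "r = {(p, q). p \<in> I \<and> q \<in> I \<and> fst p \<le> fst q}"
  define x where "x = (\<lambda>(n, y). inverse (real (Suc n)) *\<^sub>R (y :: 'a))"
  have I0: "(n, 0) \<in> I" for n using u(2) by (simp add: I_def)
  have dir: "directed_set I r"
    unfolding directed_set_def
  proof (intro conjI ballI)
    show "I \<noteq> {}" using I0 by blast
    show "preorder_on I r" by (auto simp: preorder_on_def r_def refl_on_def trans_def)
    show "\<exists>k\<in>I. (p, k) \<in> r \<and> (q, k) \<in> r" if "p \<in> I" "q \<in> I" for p q
      using that I0 by (intro bexI[of _ "(max (fst p) (fst q), 0)"]) (auto simp: r_def)
  qed
  have "order_convergent F I r x 0"
  proof (rule order_convergentI_any_net[OF _ _ decreases_to_zero_inverse[OF lattice_idealD(1)[OF F] u]])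
    show "x ` I \<subseteq> F"
      using lattice_ideal_le[OF F u(1)] lattice_idealD(1)[OF F]
      by (auto simp: x_def I_def intro: subspace_scale)
    show "0 \<in> F" using lattice_idealD(1)[OF F] by (rule subspace_0)
    show "\<forall>n\<in>UNIV. \<exists>a\<in>I. \<forall>c\<in>I. (a, c) \<in> r \<longrightarrow> \<bar>0 - x c\<bar> \<le> inverse (real (Suc n)) *\<^sub>R u"
    proof
      fix n
      have "\<bar>0 - x (m, y)\<bar> \<le> inverse (real (Suc n)) *\<^sub>R u" if "n \<le> m" "\<bar>y\<bar> \<le> u" for m y
      proof -
        have "\<bar>0 - x (m, y)\<bar> = inverse (real (Suc m)) *\<^sub>R \<bar>y\<bar>"
          by (simp add: x_def abs_scaleR_lattice)
        also have "\<dots> \<le> inverse (real (Suc n)) *\<^sub>R u"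
          using that by (intro scaleR_mono' le_imp_inverse_le) auto
        finally show ?thesis .
      qed
      then show "\<exists>a\<in>I. \<forall>c\<in>I. (a, c) \<in> r \<longrightarrow> \<bar>0 - x c\<bar> \<le> inverse (real (Suc n)) *\<^sub>R u"
        using I0[of n] by (intro bexI[of _ "(n, 0)"]) (auto simp: r_def I_def)
    qed
  qed
  from oc_dual_any_net[OF \<phi> dir this] have "eventually (\<lambda>i. \<bar>\<phi> (x i)\<bar> < 1) (tails I r)"
    by (auto simp: tendsto_iff dist_real_def dest: spec[of _ 1])
  then obtain p where p: "p \<in> I" "\<forall>q\<in>I. (p, q) \<in> r \<longrightarrow> \<bar>\<phi> (x q)\<bar> < 1"
    unfolding eventually_tails[OF dir] by blast
  \<comment> \<open>The pair \<open>(fst p, y)\<close> comes after \<open>p\<close> for every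
    admissible \<open>y\<close>, so one bound serves all of them.\<close>
  have "\<bar>\<phi> y\<bar> \<le> real (Suc (fst p))" if "\<bar>y\<bar> \<le> u" for y
  proof -
    have "(fst p, y) \<in> I" "(p, (fst p, y)) \<in> r" using p(1) that by (auto simp: I_def r_def)
    with p(2) have "\<bar>\<phi> (inverse (real (Suc (fst p))) *\<^sub>R y)\<bar> < 1" by (force simp: x_def)
    then have "inverse (real (Suc (fst p))) * \<bar>\<phi> y\<bar> < 1"
      using functional_onD(2)[OF lin lattice_ideal_le[OF F u(1) that]] by (simp add: abs_mult)
    then show ?thesis by (simp add: field_simps)
  qed
  then show ?thesis by blast
qed

section \<open>The Riesz-Kantorovich construction of the modulus\<close>

text \<open>The value of the modulus at a positive \<open>x\<close>. For any other \<open>x\<close>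
  no \<open>y\<close> is admissible, and the supremum over the empty set carries no meaning.\<close>

definition sup_below :: "('a::archimedean_vector_lattice \<Rightarrow> real) \<Rightarrow> 'a \<Rightarrow> real" where
  "sup_below \<phi> x = (SUP y\<in>{y. \<bar>y\<bar> \<le> x}. \<phi> y)"

text \<open>The Riesz-Kantorovich formula, extended from the positive cone.\<close>

definition riesz_modulus ::
    "'a::archimedean_vector_lattice set \<Rightarrow> ('a \<Rightarrow> real) \<Rightarrow> 'a \<Rightarrow> real" where
  "riesz_modulus F \<phi> x =
     (if x \<in> F then sup_below \<phi> (pprt x) - sup_below \<phi> (- nprt x) else 0)"

text \<open>Truncating \<open>c\<close> to the interval from \<open>- x\<close> to \<open>x\<close>
  gives \<open>a\<close>; what is cut off is bounded by \<open>y\<close>.\<close>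

lemma riesz_decomposition_abs:
  fixes c x y :: "'a::lattice_ab_group_add_abs"
  assumes "0 \<le> x" "0 \<le> y" "\<bar>c\<bar> \<le> x + y"
  obtains a b where "c = a + b" "\<bar>a\<bar> \<le> x" "\<bar>b\<bar> \<le> y"
proof -
  define a where "a = sup (inf c x) (- x)"
  have c: "c \<le> x + y" "- c \<le> x + y" using assms(3) by (simp_all add: abs_le_iff)
  have "a \<le> x" using assms(1) by (auto simp: a_def le_infI2 minus_le_self_iff)
  moreover have "- a \<le> x" unfolding a_def by (simp add: le_infI2)
  ultimately have "\<bar>a\<bar> \<le> x" by (rule abs_leI)
  moreover have "c - a \<le> y"
  proof -
    have "c \<le> y + inf c x"
      using c(1) assms(2) by (simp add: add_inf_distrib_left add_increasing ac_simps)
    also have "\<dots> \<le> y + a" by (simp add: a_def)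
    finally show ?thesis by (simp add: algebra_simps)
  qed
  moreover have "- (c - a) \<le> y"
  proof -
    have "a \<le> sup c (- x)" by (auto simp: a_def intro: le_infI1 le_supI1)
    also have "\<dots> \<le> c + y"
      using add_right_mono[OF c(2), of "c - x"] assms(2) by (simp add: algebra_simps)
    finally show ?thesis by (simp add: algebra_simps)
  qed
  ultimately show thesis by (intro that[of a "c - a"]) (simp_all add: abs_leI)
qed

lemma lattice_ideal_parts:
  assumes "lattice_ideal F" "x \<in> F"
  shows "pprt x \<in> F" "- nprt x \<in> F" "\<bar>x\<bar> \<in> F"
proof -
  have "\<bar>pprt x\<bar> \<le> \<bar>x\<bar>" "\<bar>- nprt x\<bar> \<le> \<bar>x\<bar>"
    using abs_prts[of x] by (simp_all add: abs_of_nonneg add_increasing le_diff_eq)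
  then show "pprt x \<in> F" "- nprt x \<in> F" "\<bar>x\<bar> \<in> F"
    using lattice_idealD(2)[OF assms] by auto
qed

context
  fixes F :: "'a::archimedean_vector_lattice set" and \<phi> :: "'a \<Rightarrow> real"
  assumes F: "lattice_ideal F" and \<phi>: "\<phi> \<in> oc_dual F"
begin

lemma oc_dual_functional: "functional_on F \<phi>"
  using \<phi> by (simp add: oc_dual_def)

lemma le_sup_below:
  assumes "x \<in> F" "\<bar>y\<bar> \<le> x"
  shows "\<phi> y \<le> sup_below \<phi> x"
proof -
  have "0 \<le> x" using abs_ge_zero[of y] assms(2) by (rule order_trans)
  then obtain M where "\<forall>y. \<bar>y\<bar> \<le> x \<longrightarrow> \<bar>\<phi> y\<bar> \<le> M"
    using oc_dual_bounded[OF F \<phi> assms(1)] by blast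
  then have "bdd_above (\<phi> ` {y. \<bar>y\<bar> \<le> x})" by (intro bdd_aboveI2[of _ _ M]) (auto simp: abs_le_iff)
  then show ?thesis unfolding sup_below_def using assms(2) by (intro cSUP_upper) auto
qed

lemma sup_below_le:
  assumes "0 \<le> x" "\<And>y. \<bar>y\<bar> \<le> x \<Longrightarrow> \<phi> y \<le> c"
  shows "sup_below \<phi> x \<le> c"
proof -
  have "0 \<in> {y. \<bar>y\<bar> \<le> x}" using assms(1) by simp
  then show ?thesis unfolding sup_below_def using assms(2) by (intro cSUP_least) blast+
qed

lemma sup_below_nonneg:
  assumes "x \<in> F" "0 \<le> x"
  shows "0 \<le> sup_below \<phi> x"
  using le_sup_below[OF assms(1), of 0] assms(2) functional_on_zero[OF oc_dual_functional] by simp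

text \<open>One inequality splits each \<open>c\<close> below \<open>x + y\<close> by the Riesz
  decomposition. The other takes the supremum over \<open>a\<close> for fixed \<open>b\<close>, and
  then the supremum over \<open>b\<close>.\<close>

lemma sup_below_add:
  assumes "x \<in> F" "0 \<le> x" "y \<in> F" "0 \<le> y"
  shows "sup_below \<phi> (x + y) = sup_below \<phi> x + sup_below \<phi> y"
proof (rule antisym)
  have xy: "x + y \<in> F" using assms lattice_idealD(1)[OF F] by (simp add: subspace_add)
  show "sup_below \<phi> (x + y) \<le> sup_below \<phi> x + sup_below \<phi> y"
  proof (rule sup_below_le)
    show "0 \<le> x + y" using assms by simp
    fix c assume "\<bar>c\<bar> \<le> x + y"
    with assms obtain a b where ab: "c = a + b" "\<bar>a\<bar> \<le> x" "\<bar>b\<bar> \<le> y"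
      using riesz_decomposition_abs by metis
    then have "\<phi> c = \<phi> a + \<phi> b"
      using functional_onD(1)[OF oc_dual_functional] lattice_ideal_le[OF F] assms by blast
    with le_sup_below[OF assms(1) ab(2)] le_sup_below[OF assms(3) ab(3)]
    show "\<phi> c \<le> sup_below \<phi> x + sup_below \<phi> y" by simp
  qed
  have "\<phi> a + \<phi> b \<le> sup_below \<phi> (x + y)" if "\<bar>a\<bar> \<le> x" "\<bar>b\<bar> \<le> y" for a b
  proof -
    have "\<bar>a + b\<bar> \<le> x + y"
      using abs_triangle_ineq[of a b] add_mono[OF that] by (rule order_trans)
    from le_sup_below[OF xy this] show ?thesis
      using functional_onD(1)[OF oc_dual_functional] lattice_ideal_le[OF F] assms that by metis
  qed
  then have "\<phi> a \<le> sup_below \<phi> (x + y) - \<phi> b" if "\<bar>a\<bar> \<le> x" "\<bar>b\<bar> \<le> y" for a b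
    using that by (simp add: le_diff_eq)
  then have "sup_below \<phi> x \<le> sup_below \<phi> (x + y) - \<phi> b" if "\<bar>b\<bar> \<le> y" for b
    using that by (intro sup_below_le[OF assms(2)])
  then have "\<phi> b \<le> sup_below \<phi> (x + y) - sup_below \<phi> x" if "\<bar>b\<bar> \<le> y" for b
    using that by (simp add: algebra_simps)
  then have "sup_below \<phi> y \<le> sup_below \<phi> (x + y) - sup_below \<phi> x"
    by (intro sup_below_le[OF assms(4)])
  then show "sup_below \<phi> x + sup_below \<phi> y \<le> sup_below \<phi> (x + y)" by simp
qed

lemma sup_below_scaleR:
  assumes "x \<in> F" "0 \<le> x" "0 < c"
  shows "sup_below \<phi> (c *\<^sub>R x) = c * sup_below \<phi> x"
proof (rule antisym)
  have le: "d * sup_below \<phi> y \<le> sup_below \<phi> (d *\<^sub>R y)" if y: "y \<in> F" "0 \<le> y" and d: "0 < d" for d y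
  proof -
    have "sup_below \<phi> y \<le> sup_below \<phi> (d *\<^sub>R y) / d"
    proof (rule sup_below_le[OF y(2)])
      fix z assume z: "\<bar>z\<bar> \<le> y"
      then have "\<bar>d *\<^sub>R z\<bar> \<le> d *\<^sub>R y" using d by (simp add: abs_scaleR_lattice scaleR_left_mono)
      with le_sup_below have "\<phi> (d *\<^sub>R z) \<le> sup_below \<phi> (d *\<^sub>R y)"
        using y(1) lattice_idealD(1)[OF F] by (simp add: subspace_scale)
      then show "\<phi> z \<le> sup_below \<phi> (d *\<^sub>R y) / d"
        using functional_onD(2)[OF oc_dual_functional lattice_ideal_le[OF F y(1) z]] d
        by (simp add: field_simps)
    qed
    then show ?thesis using d by (simp add: field_simps)
  qed
  show "c * sup_below \<phi> x \<le> sup_below \<phi> (c *\<^sub>R x)" by (rule le[OF assms])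
  \<comment> \<open>The reverse inequality is \<open>le\<close> for the inverse of \<open>c\<close>
    at the point \<open>c *\<^sub>R x\<close>.\<close>
  have "c *\<^sub>R x \<in> F" "0 \<le> c *\<^sub>R x" "0 < inverse c"
    using assms lattice_idealD(1)[OF F] by (auto simp: subspace_scale scaleR_nonneg_nonneg)
  from le[OF this] show "sup_below \<phi> (c *\<^sub>R x) \<le> c * sup_below \<phi> x"
    using assms(3) by (simp add: field_simps)
qed

text \<open>The definition uses the canonical parts of an element, but any representation as a
  difference of positive elements gives the same value: move the negative terms to the other side
  and apply additivity.\<close>

lemma riesz_modulus_diff:
  assumes "a \<in> F" "0 \<le> a" "b \<in> F" "0 \<le> b"
  shows "riesz_modulus F \<phi> (a - b) = sup_below \<phi> a - sup_below \<phi> b"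
proof -
  have ab: "a - b \<in> F" using assms lattice_idealD(1)[OF F] by (simp add: subspace_diff)
  note parts = lattice_ideal_parts[OF F ab]
  have "a + - nprt (a - b) = b + pprt (a - b)"
    using prts[of "a - b"] by (simp add: algebra_simps)
  then have "sup_below \<phi> a + sup_below \<phi> (- nprt (a - b)) = sup_below \<phi> b + sup_below \<phi> (pprt (a - b))"
    using sup_below_add[OF assms(1,2) parts(2)] sup_below_add[OF assms(3,4) parts(1)] by simp
  then show ?thesis using ab by (simp add: riesz_modulus_def)
qed

lemma riesz_modulus_pos:
  assumes "a \<in> F" "0 \<le> a"
  shows "riesz_modulus F \<phi> a = sup_below \<phi> a"
proof -
  have "sup_below \<phi> 0 = 0"
    using sup_below_add[of 0 0] subspace_0[OF lattice_idealD(1)[OF F]] by simp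
  with riesz_modulus_diff[OF assms, of 0] subspace_0[OF lattice_idealD(1)[OF F]]
  show ?thesis by simp
qed

lemma riesz_modulus_functional: "functional_on F (riesz_modulus F \<phi>)"
  unfolding functional_on_def
proof (intro conjI ballI allI impI)
  note sub = lattice_idealD(1)[OF F]
  have split: "\<exists>a b. x = a - b \<and> a \<in> F \<and> 0 \<le> a \<and> b \<in> F \<and> 0 \<le> b" if "x \<in> F" for x
    using prts[of x] lattice_ideal_parts[OF F that]
    by (intro exI[of _ "pprt x"] exI[of _ "- nprt x"]) simp
  fix x assume "x \<in> F"
  with split obtain a b where x: "x = a - b" "a \<in> F" "0 \<le> a" "b \<in> F" "0 \<le> b" by blast
  show "riesz_modulus F \<phi> (x + y) = riesz_modulus F \<phi> x + riesz_modulus F \<phi> y" if "y \<in> F" for y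
  proof -
    from split that obtain a' b' where y: "y = a' - b'" "a' \<in> F" "0 \<le> a'" "b' \<in> F" "0 \<le> b'" by blast
    have xy: "x + y = (a + a') - (b + b')" using x y by simp
    have "riesz_modulus F \<phi> (x + y) = sup_below \<phi> (a + a') - sup_below \<phi> (b + b')"
      unfolding xy by (rule riesz_modulus_diff) (use x y in \<open>simp_all add: subspace_add[OF sub]\<close>)
    then show ?thesis using x y by (simp add: riesz_modulus_diff sup_below_add)
  qed
  show "riesz_modulus F \<phi> (c *\<^sub>R x) = c * riesz_modulus F \<phi> x" for c
  proof -
    consider "c = 0" | "0 < c" | "c < 0" by linarith
    then show ?thesis
    proof cases
      case 1
      then show ?thesis using riesz_modulus_diff[of 0 0] subspace_0[OF sub] by simp
    next
      case 2
      have "c *\<^sub>R x = c *\<^sub>R a - c *\<^sub>R b" using x(1) by (simp add: scaleR_diff_right)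
      then show ?thesis
        using riesz_modulus_diff[of "c *\<^sub>R a" "c *\<^sub>R b"] x 2
        by (simp add: riesz_modulus_diff sup_below_scaleR subspace_scale[OF sub]
            scaleR_nonneg_nonneg right_diff_distrib)
    next
      case 3
      \<comment> \<open>A negative scalar exchanges the two positive elements of the
        representation.\<close>
      have cx: "c *\<^sub>R x = (- c) *\<^sub>R b - (- c) *\<^sub>R a" using x(1) by (simp add: scaleR_diff_right)
      have "riesz_modulus F \<phi> (c *\<^sub>R x) = sup_below \<phi> ((- c) *\<^sub>R b) - sup_below \<phi> ((- c) *\<^sub>R a)"
        unfolding cx
        by (rule riesz_modulus_diff; (rule subspace_scale[OF sub] scaleR_nonneg_nonneg)?) (use x 3 in auto)
      then show ?thesis
        using sup_below_scaleR[of a "- c"] sup_below_scaleR[of b "- c"] riesz_modulus_diff[of a b] x 3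
        by (simp add: right_diff_distrib)
    qed
  qed
qed (simp add: riesz_modulus_def)

text \<open>Being nonnegative on positive elements, the functional is monotone and maps order
  intervals into bounded intervals.\<close>

lemma riesz_modulus_order_dual: "riesz_modulus F \<phi> \<in> order_dual F"
proof -
  note sub = lattice_idealD(1)[OF F]
  have mono: "riesz_modulus F \<phi> x \<le> riesz_modulus F \<phi> y" if "x \<in> F" "y \<in> F" "x \<le> y" for x y
  proof -
    have "y - x \<in> F" "0 \<le> y - x" using that by (auto simp: subspace_diff[OF sub])
    then have "0 \<le> riesz_modulus F \<phi> (y - x)"
      by (simp add: riesz_modulus_pos sup_below_nonneg)
    then show ?thesis
      using functional_on_diff[OF riesz_modulus_functional sub that(2,1)] by simp
  qed
  have "bounded (riesz_modulus F \<phi> ` (F \<inter> {a..b}))" if "a \<in> F" "b \<in> F" for a b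
  proof (rule bounded_subset[OF bounded_closed_interval])
    show "riesz_modulus F \<phi> ` (F \<inter> {a..b}) \<subseteq> {riesz_modulus F \<phi> a..riesz_modulus F \<phi> b}"
      using mono that by auto
  qed
  then show ?thesis by (simp add: order_dual_def riesz_modulus_functional)
qed

lemma riesz_modulus_upper:
  "dual_le F \<phi> (riesz_modulus F \<phi>)" "dual_le F (\<lambda>x. - \<phi> x) (riesz_modulus F \<phi>)"
proof -
  have "\<phi> x \<le> sup_below \<phi> x" "- \<phi> x \<le> sup_below \<phi> x" if "x \<in> F" "0 \<le> x" for x
    using le_sup_below[OF that(1), of x] le_sup_below[OF that(1), of "- x"] that
      functional_on_minus[OF oc_dual_functional that(1)] by (simp_all add: abs_of_nonneg)
  then show "dual_le F \<phi> (riesz_modulus F \<phi>)" "dual_le F (\<lambda>x. - \<phi> x) (riesz_modulus F \<phi>)"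
    by (auto simp: dual_le_def riesz_modulus_pos)
qed

text \<open>Splitting \<open>y\<close> into positive and negative parts bounds
  \<open>\<phi> y\<close> by \<open>\<xi> \<bar>y\<bar>\<close>. Adding the two inequalities in
  \<open>up\<close> shows that \<open>\<xi>\<close> is nonnegative on positive elements, so
  \<open>\<xi> \<bar>y\<bar> \<le> \<xi> x\<close>.\<close>

lemma riesz_modulus_least:
  assumes \<xi>: "\<xi> \<in> order_dual F" and le: "dual_le F \<phi> \<xi>" "dual_le F (\<lambda>x. - \<phi> x) \<xi>"
  shows "dual_le F (riesz_modulus F \<phi>) \<xi>"
  unfolding dual_le_def
proof (intro ballI impI)
  note sub = lattice_idealD(1)[OF F]
  have lin: "functional_on F \<xi>" using \<xi> by (simp add: order_dual_def)
  have up: "\<phi> x \<le> \<xi> x" "- \<phi> x \<le> \<xi> x" if "x \<in> F" "0 \<le> x" for x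
    using le that by (auto simp: dual_le_def)
  fix x assume x: "x \<in> F" "0 \<le> x"
  have "sup_below \<phi> x \<le> \<xi> x"
  proof (rule sup_below_le[OF x(2)])
    fix y assume y: "\<bar>y\<bar> \<le> x"
    have yF: "y \<in> F" by (rule lattice_ideal_le[OF F x(1) y])
    note parts = lattice_ideal_parts[OF F yF]
    have "y = pprt y - (- nprt y)" using prts[of y] by simp
    then have "\<phi> y = \<phi> (pprt y) - \<phi> (- nprt y)"
      using functional_on_diff[OF oc_dual_functional sub parts(1,2)] by simp
    also have "\<dots> \<le> \<xi> (pprt y) + \<xi> (- nprt y)"
      using up(1)[OF parts(1)] up(2)[OF parts(2)] by simp
    also have "\<dots> = \<xi> \<bar>y\<bar>"
      using functional_onD(1)[OF lin parts(1,2)] abs_prts[of y] by simp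
    also have "\<dots> \<le> \<xi> x"
    proof -
      have d: "x - \<bar>y\<bar> \<in> F" "0 \<le> x - \<bar>y\<bar>"
        using x parts(3) y by (auto simp: subspace_diff[OF sub])
      have "0 \<le> \<xi> (x - \<bar>y\<bar>)" using up[OF d] by simp
      then show ?thesis using functional_on_diff[OF lin sub x(1) parts(3)] by simp
    qed
    finally show "\<phi> y \<le> \<xi> x" .
  qed
  then show "riesz_modulus F \<phi> x \<le> \<xi> x" using x by (simp add: riesz_modulus_pos)
qed

text \<open>Two least upper bounds agree on the positive elements of \<open>F\<close>, hence on
  \<open>F\<close> by taking differences, and outside \<open>F\<close> both are zero by
  convention.\<close>

lemma modulus_eq_riesz_modulus: "modulus F \<phi> = riesz_modulus F \<phi>"
  unfolding modulus_def
proof (rule the_equality)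
  show "riesz_modulus F \<phi> \<in> order_dual F \<and> dual_le F \<phi> (riesz_modulus F \<phi>) \<and>
      dual_le F (\<lambda>x. - \<phi> x) (riesz_modulus F \<phi>) \<and>
      (\<forall>\<xi>\<in>order_dual F. dual_le F \<phi> \<xi> \<longrightarrow> dual_le F (\<lambda>x. - \<phi> x) \<xi> \<longrightarrow>
        dual_le F (riesz_modulus F \<phi>) \<xi>)"
    using riesz_modulus_order_dual riesz_modulus_upper riesz_modulus_least by blast
  fix \<psi>
  assume \<psi>: "\<psi> \<in> order_dual F \<and> dual_le F \<phi> \<psi> \<and> dual_le F (\<lambda>x. - \<phi> x) \<psi> \<and>
      (\<forall>\<xi>\<in>order_dual F. dual_le F \<phi> \<xi> \<longrightarrow> dual_le F (\<lambda>x. - \<phi> x) \<xi> \<longrightarrow> dual_le F \<psi> \<xi>)"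
  then have "dual_le F (riesz_modulus F \<phi>) \<psi>" "dual_le F \<psi> (riesz_modulus F \<phi>)"
    using riesz_modulus_least riesz_modulus_order_dual riesz_modulus_upper by blast+
  then have pos: "\<psi> x = riesz_modulus F \<phi> x" if "x \<in> F" "0 \<le> x" for x
    using that by (auto simp: dual_le_def intro: antisym)
  have lin: "functional_on F \<psi>" using \<psi> by (simp add: order_dual_def)
  show "\<psi> = riesz_modulus F \<phi>"
  proof
    fix x
    show "\<psi> x = riesz_modulus F \<phi> x"
    proof (cases "x \<in> F")
      case True
      note parts = lattice_ideal_parts[OF F True]
      note diff = functional_on_diff[OF _ lattice_idealD(1)[OF F] parts(1,2)]
      have "pprt x - (- nprt x) = x" using prts[of x] by simp
      with diff[OF lin] diff[OF riesz_modulus_functional] pos[OF parts(1)] pos[OF parts(2)]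
      show ?thesis by simp
    next
      case False
      with functional_onD(3)[OF lin] functional_onD(3)[OF riesz_modulus_functional]
      show ?thesis by simp
    qed
  qed
qed

lemma modulus_eq_sup_below: "x \<in> F \<Longrightarrow> 0 \<le> x \<Longrightarrow> modulus F \<phi> x = sup_below \<phi> x"
  by (simp add: modulus_eq_riesz_modulus riesz_modulus_pos)

lemma modulus_nonneg: "x \<in> F \<Longrightarrow> 0 \<le> x \<Longrightarrow> 0 \<le> modulus F \<phi> x"
  by (simp add: modulus_eq_sup_below sup_below_nonneg)

lemma modulus_add:
  "x \<in> F \<Longrightarrow> 0 \<le> x \<Longrightarrow> y \<in> F \<Longrightarrow> 0 \<le> y \<Longrightarrow>
    modulus F \<phi> (x + y) = modulus F \<phi> x + modulus F \<phi> y"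
  using functional_onD(1)[OF riesz_modulus_functional]
  by (simp add: modulus_eq_riesz_modulus)

lemma modulus_mono:
  assumes "y \<in> F" "0 \<le> x" "x \<le> y"
  shows "modulus F \<phi> x \<le> modulus F \<phi> y"
proof -
  have x: "x \<in> F" using assms lattice_ideal_le[OF F, of y x] by (simp add: abs_of_nonneg)
  then have "y - x \<in> F" "0 \<le> y - x"
    using assms lattice_idealD(1)[OF F] by (auto simp: subspace_diff)
  with modulus_add[OF x assms(2) this] modulus_nonneg[OF this] show ?thesis by simp
qed

lemma modulus_zero: "modulus F \<phi> 0 = 0"
  using functional_on_zero[OF riesz_modulus_functional] by (simp add: modulus_eq_riesz_modulus)

lemma le_modulus:
  assumes "x \<in> F" "\<bar>y\<bar> \<le> x"
  shows "\<bar>\<phi> y\<bar> \<le> modulus F \<phi> x"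
proof -
  have "0 \<le> x" using abs_ge_zero[of y] assms(2) by (rule order_trans)
  then show ?thesis
    using le_sup_below[OF assms] le_sup_below[OF assms(1), of "- y"] assms
      functional_on_minus[OF oc_dual_functional lattice_ideal_le[OF F assms]]
    by (simp add: modulus_eq_sup_below abs_le_iff)
qed

lemma modulus_le:
  assumes "x \<in> F" "0 \<le> x" "\<And>y. \<bar>y\<bar> \<le> x \<Longrightarrow> \<phi> y \<le> c"
  shows "modulus F \<phi> x \<le> c"
  using sup_below_le[OF assms(2,3)] assms(1,2) by (simp add: modulus_eq_sup_below)

text \<open>
  Choosing \<open>v i\<close> with \<open>\<bar>v i\<bar> \<le> \<bar>x i\<bar>\<close> and \<open>\<phi> (v i)\<close> close to \<open>\<bar>\<phi>\<bar> \<bar>x i\<bar>\<close> gives a net dominated like \<open>x\<close>.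
\<close>

lemma modulus_order_continuous:
  fixes x :: "'i \<Rightarrow> 'a"
  assumes dir: "directed_set I r" and x: "order_convergent F I r x 0"
  shows "((\<lambda>i. modulus F \<phi> \<bar>x i\<bar>) \<longlongrightarrow> 0) (tails I r)"
proof (rule tendstoI)
  fix e :: real assume e: "0 < e"
  have xF: "x i \<in> F" if "i \<in> I" for i using x that by (auto simp: order_convergent_def)
  have "\<exists>v. \<bar>v\<bar> \<le> \<bar>x i\<bar> \<and> modulus F \<phi> \<bar>x i\<bar> - e / 2 \<le> \<phi> v" if "i \<in> I" for i
  proof (rule ccontr)
    assume "\<not> ?thesis"
    \<comment> \<open>Otherwise \<open>modulus_le\<close> would bound the modulus at
      \<open>\<bar>x i\<bar>\<close> by itself minus \<open>e / 2\<close>.\<close>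
    then have "\<phi> v \<le> modulus F \<phi> \<bar>x i\<bar> - e / 2" if "\<bar>v\<bar> \<le> \<bar>x i\<bar>" for v
      using that by (meson linear)
    from modulus_le[OF lattice_ideal_parts(3)[OF F xF[OF that]] _ this] e show False by simp
  qed
  then obtain v where v: "\<And>i. i \<in> I \<Longrightarrow> \<bar>v i\<bar> \<le> \<bar>x i\<bar>"
    "\<And>i. i \<in> I \<Longrightarrow> modulus F \<phi> \<bar>x i\<bar> - e / 2 \<le> \<phi> (v i)" by metis
  have "order_convergent F I r v 0"
  proof -
    obtain J :: "'a set" and s y where y: "decreases_to_zero F J s y"
      "\<forall>b\<in>J. \<exists>a\<in>I. \<forall>c\<in>I. (a, c) \<in> r \<longrightarrow> \<bar>0 - x c\<bar> \<le> y b"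
      using x by (auto simp: order_convergent_def)
    show ?thesis
    proof (rule order_convergentI_any_net[OF _ _ y(1)])
      show "v ` I \<subseteq> F" using lattice_idealD(2)[OF F xF v(1)] by blast
      show "0 \<in> F" by (rule subspace_0[OF lattice_idealD(1)[OF F]])
      show "\<forall>b\<in>J. \<exists>a\<in>I. \<forall>c\<in>I. (a, c) \<in> r \<longrightarrow> \<bar>0 - v c\<bar> \<le> y b"
      proof
        fix b assume "b \<in> J"
        with y(2) obtain a where "a \<in> I" "\<forall>c\<in>I. (a, c) \<in> r \<longrightarrow> \<bar>x c\<bar> \<le> y b" by auto
        with v(1) show "\<exists>a\<in>I. \<forall>c\<in>I. (a, c) \<in> r \<longrightarrow> \<bar>0 - v c\<bar> \<le> y b"
          by (intro bexI[of _ a]) (auto intro: order_trans)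
      qed
    qed
  qed
  from oc_dual_any_net[OF \<phi> dir this]
  have "eventually (\<lambda>i. dist (\<phi> (v i)) 0 < e / 2) (tails I r)"
    using e by (intro tendstoD) simp_all
  then obtain a where a: "a \<in> I" "\<forall>b\<in>I. (a, b) \<in> r \<longrightarrow> dist (\<phi> (v b)) 0 < e / 2"
    unfolding eventually_tails[OF dir] by blast
  have "dist (modulus F \<phi> \<bar>x b\<bar>) 0 < e" if "b \<in> I" "(a, b) \<in> r" for b
  proof -
    have "\<bar>\<phi> (v b)\<bar> < e / 2" using a(2) that by (simp add: dist_real_def)
    with v(2)[OF that(1)] modulus_nonneg[OF lattice_ideal_parts(3)[OF F xF[OF that(1)]]]
    show ?thesis by (simp add: dist_real_def abs_less_iff)
  qed
  with a(1) show "eventually (\<lambda>i. dist (modulus F \<phi> \<bar>x i\<bar>) 0 < e) (tails I r)"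
    unfolding eventually_tails[OF dir] by blast
qed

end

section \<open>Ideals in the order continuous dual\<close>

lemma oc_dual_add:
  assumes "\<phi> \<in> oc_dual F" "\<psi> \<in> oc_dual F"
  shows "(\<lambda>x. \<phi> x + \<psi> x) \<in> oc_dual F"
proof -
  have "functional_on F (\<lambda>x. \<phi> x + \<psi> x)"
    using assms by (auto simp: oc_dual_def functional_on_def algebra_simps)
  moreover have "((\<lambda>i. \<phi> (x i) + \<psi> (x i)) \<longlongrightarrow> 0) (tails I r)"
    if "directed_set I r" "order_convergent F I r x 0" for I :: "('a \<times> 'a set) set" and r x
    using tendsto_add[OF oc_dual_any_net[OF assms(1) that] oc_dual_any_net[OF assms(2) that]] by simp
  ultimately show ?thesis by (simp add: oc_dual_def)
qed

lemma oc_dual_scale: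
  assumes "\<phi> \<in> oc_dual F"
  shows "(\<lambda>x. c * \<phi> x) \<in> oc_dual F"
proof -
  have "functional_on F (\<lambda>x. c * \<phi> x)"
    using assms by (auto simp: oc_dual_def functional_on_def algebra_simps)
  moreover have "((\<lambda>i. c * \<phi> (x i)) \<longlongrightarrow> 0) (tails I r)"
    if "directed_set I r" "order_convergent F I r x 0" for I :: "('a \<times> 'a set) set" and r x
    using tendsto_mult_left[OF oc_dual_any_net[OF assms that], of c] by simp
  ultimately show ?thesis by (simp add: oc_dual_def)
qed

lemma oc_dual_zero: "(\<lambda>x. 0) \<in> oc_dual F"
  by (simp add: oc_dual_def functional_on_def)

lemma oc_dual_ideal_oc_dual: "oc_dual_ideal F (oc_dual F)"
  using oc_dual_add oc_dual_scale oc_dual_zero by (auto simp: oc_dual_ideal_def)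

text \<open>The condition says that \<open>\<phi>\<close> vanishes at every \<open>y\<close> with
  \<open>\<bar>y\<bar> \<le> w\<close>, which is stable under linear combinations. By minimality of
  hulls, vanishing of the modulus at \<open>w\<close> thus passes from a set of functionals to the
  ideal generated by it.\<close>

lemma oc_dual_ideal_null:
  assumes F: "lattice_ideal F" and w: "w \<in> F" "0 \<le> w"
  shows "oc_dual_ideal F {\<phi> \<in> oc_dual F. modulus F \<phi> w = 0}"
  unfolding oc_dual_ideal_def
proof (intro conjI ballI allI impI)
  show "(\<lambda>x. 0) \<in> {\<phi> \<in> oc_dual F. modulus F \<phi> w = 0}"
    using modulus_le[OF F oc_dual_zero w, of 0] modulus_nonneg[OF F oc_dual_zero w] oc_dual_zero by simp
  fix \<psi> assume "\<psi> \<in> {\<phi> \<in> oc_dual F. modulus F \<phi> w = 0}"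
  then have \<psi>: "\<psi> \<in> oc_dual F" "modulus F \<psi> w = 0" by auto
  have null: "\<psi> y = 0" if "\<bar>y\<bar> \<le> w" for y using le_modulus[OF F \<psi>(1) w(1) that] \<psi>(2) by simp
  show "(\<lambda>x. c * \<psi> x) \<in> {\<phi> \<in> oc_dual F. modulus F \<phi> w = 0}" for c
    using modulus_le[OF F oc_dual_scale[OF \<psi>(1)] w, of c 0]
      modulus_nonneg[OF F oc_dual_scale[OF \<psi>(1)] w, of c] oc_dual_scale[OF \<psi>(1)] null by simp
  show "\<phi> \<in> {\<phi> \<in> oc_dual F. modulus F \<phi> w = 0}"
    if "\<phi> \<in> oc_dual F" "dual_le F (modulus F \<phi>) (modulus F \<psi>)" for \<phi>
    using that w \<psi>(2) modulus_nonneg[OF F that(1) w] by (fastforce simp: dual_le_def)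
  fix \<phi> assume "\<phi> \<in> {\<phi> \<in> oc_dual F. modulus F \<phi> w = 0}"
  then have \<phi>: "\<phi> \<in> oc_dual F" "modulus F \<phi> w = 0" by auto
  have "\<phi> y = 0" if "\<bar>y\<bar> \<le> w" for y using le_modulus[OF F \<phi>(1) w(1) that] \<phi>(2) by simp
  then show "(\<lambda>x. \<phi> x + \<psi> x) \<in> {\<phi> \<in> oc_dual F. modulus F \<phi> w = 0}"
    using modulus_le[OF F oc_dual_add[OF \<phi>(1) \<psi>(1)] w, of 0]
      modulus_nonneg[OF F oc_dual_add[OF \<phi>(1) \<psi>(1)] w] oc_dual_add[OF \<phi>(1) \<psi>(1)] null by simp
qed blast


section \<open>Topologies generated by solid neighbourhood bases\<close>

text \<open>Translates of the members of \<open>B\<close> serve as neighbourhoods. That the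
  predicate is indeed a topology is shown under the conditions of \<open>solid_base\<close>.\<close>

definition base_topology :: "'a::ab_group_add set set \<Rightarrow> 'a topology" where
  "base_topology B = topology (\<lambda>U. \<forall>x\<in>U. \<exists>V\<in>B. \<forall>v\<in>V. x + v \<in> U)"

text \<open>Solidity makes the members balanced; with \<open>add\<close> and
  \<open>absorbing\<close> this gives continuity of scalar multiplication.\<close>

locale solid_base =
  fixes B :: "'a::archimedean_vector_lattice set set"
  assumes nonempty: "B \<noteq> {}"
    and zero: "V \<in> B \<Longrightarrow> 0 \<in> V"
    and solid: "V \<in> B \<Longrightarrow> y \<in> V \<Longrightarrow> \<bar>x\<bar> \<le> \<bar>y\<bar> \<Longrightarrow> x \<in> V"
    and Int: "V \<in> B \<Longrightarrow> W \<in> B \<Longrightarrow> \<exists>R\<in>B. R \<subseteq> V \<inter> W"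
    and add: "V \<in> B \<Longrightarrow> \<exists>W\<in>B. \<forall>a\<in>W. \<forall>b\<in>W. a + b \<in> V"
    and absorbing: "V \<in> B \<Longrightarrow> \<exists>e>0. \<forall>c. \<bar>c\<bar> < e \<longrightarrow> c *\<^sub>R x \<in> V"
begin

lemma openin_base_topology:
  "openin (base_topology B) U \<longleftrightarrow> (\<forall>x\<in>U. \<exists>V\<in>B. \<forall>v\<in>V. x + v \<in> U)"
proof -
  have "istopology (\<lambda>U. \<forall>x\<in>U. \<exists>V\<in>B. \<forall>v\<in>V. x + v \<in> U)"
    unfolding istopology_def
  proof (intro conjI allI impI ballI)
    fix U U' x
    assume U: "\<forall>x\<in>U. \<exists>V\<in>B. \<forall>v\<in>V. x + v \<in> U" "\<forall>x\<in>U'. \<exists>V\<in>B. \<forall>v\<in>V. x + v \<in> U'"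
      and "x \<in> U \<inter> U'"
    then obtain V V' where "V \<in> B" "\<forall>v\<in>V. x + v \<in> U" "V' \<in> B" "\<forall>v\<in>V'. x + v \<in> U'" by blast
    moreover obtain R where "R \<in> B" "R \<subseteq> V \<inter> V'" using Int calculation(1,3) by blast
    ultimately show "\<exists>V\<in>B. \<forall>v\<in>V. x + v \<in> U \<inter> U'" by (intro bexI[of _ R]) auto
  next
    fix \<U> x assume "\<forall>U\<in>\<U>. \<forall>x\<in>U. \<exists>V\<in>B. \<forall>v\<in>V. x + v \<in> U" "x \<in> \<Union>\<U>"
    then obtain U V where "U \<in> \<U>" "V \<in> B" "\<forall>v\<in>V. x + v \<in> U" by blast
    then show "\<exists>V\<in>B. \<forall>v\<in>V. x + v \<in> \<Union>\<U>" by blast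
  qed
  then show ?thesis by (simp add: base_topology_def topology_inverse')
qed

lemma topspace_base_topology: "topspace (base_topology B) = UNIV"
proof -
  have "openin (base_topology B) UNIV" using nonempty by (auto simp: openin_base_topology)
  then show ?thesis using openin_subset by blast
qed

text \<open>The set \<open>?W\<close> is the interior of \<open>x + V\<close>; halving
  \<open>R\<close> shows that it is open.\<close>

lemma base_nbhd:
  assumes "V \<in> B"
  obtains W where "openin (base_topology B) W" "x \<in> W" "\<forall>w\<in>W. w - x \<in> V"
proof
  let ?W = "{w. \<exists>R\<in>B. \<forall>v\<in>R. w + v - x \<in> V}"
  show "openin (base_topology B) ?W"
    unfolding openin_base_topology
  proof
    fix w assume "w \<in> ?W"
    then obtain R where R: "R \<in> B" "\<forall>v\<in>R. w + v - x \<in> V" by blast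
    obtain R' where R': "R' \<in> B" "\<forall>a\<in>R'. \<forall>b\<in>R'. a + b \<in> R" using add[OF R(1)] by blast
    have "w + v \<in> ?W" if "v \<in> R'" for v
    proof -
      have "w + v + v' - x \<in> V" if "v' \<in> R'" for v'
        using R(2) R'(2) \<open>v \<in> R'\<close> that by (metis add.assoc)
      with R'(1) show ?thesis by blast
    qed
    with R'(1) show "\<exists>R\<in>B. \<forall>v\<in>R. w + v \<in> ?W" by blast
  qed
  show "x \<in> ?W" using assms by auto
  show "\<forall>w\<in>?W. w - x \<in> V" using zero by force
qed

text \<open>Solidity handles scalars of absolute value at most 1. Each doubling of the bound costs
  one use of \<open>add\<close>, because \<open>c *\<^sub>R w\<close> equals
  \<open>(c / 2) *\<^sub>R (w + w)\<close>.\<close>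

lemma base_scale: "V \<in> B \<Longrightarrow> \<exists>W\<in>B. \<forall>w\<in>W. \<forall>c. \<bar>c\<bar> \<le> 2 ^ k \<longrightarrow> c *\<^sub>R w \<in> V"
proof (induction k)
  case 0
  have "c *\<^sub>R w \<in> V" if "w \<in> V" "\<bar>c\<bar> \<le> 1" for w c
    using scaleR_right_mono[OF that(2), of "\<bar>w\<bar>"]
    by (intro solid[OF 0 that(1)]) (simp add: abs_scaleR_lattice)
  with 0 show ?case by auto
next
  case (Suc k)
  then obtain W where W: "W \<in> B" "\<forall>w\<in>W. \<forall>c. \<bar>c\<bar> \<le> 2 ^ k \<longrightarrow> c *\<^sub>R w \<in> V" by blast
  obtain R where R: "R \<in> B" "\<forall>a\<in>R. \<forall>b\<in>R. a + b \<in> W" using add[OF W(1)] by blast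
  have "c *\<^sub>R w \<in> V" if "w \<in> R" "\<bar>c\<bar> \<le> 2 ^ Suc k" for w c
  proof -
    have "(c / 2) *\<^sub>R (w + w) \<in> V" using W(2) R(2) that by simp
    then show ?thesis by (simp add: scaleR_2[symmetric])
  qed
  with R(1) show ?case by blast
qed

lemma continuous_map_base_add:
  "continuous_map (prod_topology (base_topology B) (base_topology B)) (base_topology B) (\<lambda>(x, y). x + y)"
  (is "continuous_map (prod_topology ?T ?T) ?T _")
proof -
  have "openin (prod_topology ?T ?T) {p. fst p + snd p \<in> U}" if U: "openin ?T U" for U
    unfolding openin_prod_topology_alt
  proof (intro allI impI)
    fix x y assume "(x, y) \<in> {p. fst p + snd p \<in> U}"
    with U obtain V where V: "V \<in> B" "\<forall>v\<in>V. x + y + v \<in> U" by (auto simp: openin_base_topology)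
    obtain R where R: "R \<in> B" "\<forall>a\<in>R. \<forall>b\<in>R. a + b \<in> V" using add[OF V(1)] by blast
    obtain X where X: "openin ?T X" "x \<in> X" "\<forall>w\<in>X. w - x \<in> R" by (rule base_nbhd[OF R(1), of x])
    obtain Y where Y: "openin ?T Y" "y \<in> Y" "\<forall>w\<in>Y. w - y \<in> R" by (rule base_nbhd[OF R(1), of y])
    have "a + b \<in> U" if "a \<in> X" "b \<in> Y" for a b
    proof -
      have "x + y + ((a - x) + (b - y)) \<in> U" using V(2) R(2) X(3) Y(3) that by blast
      then show ?thesis by (simp add: algebra_simps)
    qed
    with X(1,2) Y(1,2) show "\<exists>X Y. openin ?T X \<and> openin ?T Y \<and> x \<in> X \<and> y \<in> Y \<and>
        X \<times> Y \<subseteq> {p. fst p + snd p \<in> U}"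
      by (intro exI[of _ X] exI[of _ Y]) auto
  qed
  then show ?thesis by (simp add: continuous_map_def topspace_base_topology case_prod_beta)
qed

lemma continuous_map_base_scaleR:
  "continuous_map (prod_topology euclidean (base_topology B)) (base_topology B) (\<lambda>(c::real, x). c *\<^sub>R x)"
  (is "continuous_map (prod_topology _ ?T) ?T _")
proof -
  have "openin (prod_topology euclidean ?T) {p. fst p *\<^sub>R snd p \<in> U}" if U: "openin ?T U" for U
    unfolding openin_prod_topology_alt
  proof (intro allI impI)
    fix c :: real and x assume "(c, x) \<in> {p. fst p *\<^sub>R snd p \<in> U}"
    with U obtain V where V: "V \<in> B" "\<forall>v\<in>V. c *\<^sub>R x + v \<in> U" by (auto simp: openin_base_topology)
    obtain R where R: "R \<in> B" "\<forall>a\<in>R. \<forall>b\<in>R. a + b \<in> V" using add[OF V(1)] by blast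
    obtain e where e: "0 < e" "\<And>d. \<bar>d\<bar> < e \<Longrightarrow> d *\<^sub>R x \<in> R" using absorbing[OF R(1)] by blast
    \<comment> \<open>The bound \<open>2 ^ k\<close> covers all scalars \<open>d\<close> at distance
      less than 1 from \<open>c\<close>. The difference of \<open>d *\<^sub>R y\<close> and
      \<open>c *\<^sub>R x\<close> is then split into \<open>d *\<^sub>R (y - x)\<close> and
      \<open>(d - c) *\<^sub>R x\<close>.\<close>
    obtain k where k: "\<bar>c\<bar> + 1 < 2 ^ k" using real_arch_pow[of 2 "\<bar>c\<bar> + 1"] by auto
    obtain R' where R': "R' \<in> B" "\<forall>w\<in>R'. \<forall>c. \<bar>c\<bar> \<le> 2 ^ k \<longrightarrow> c *\<^sub>R w \<in> R"
      using base_scale[OF R(1)] by blast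
    obtain Y where Y: "openin ?T Y" "x \<in> Y" "\<forall>w\<in>Y. w - x \<in> R'" by (rule base_nbhd[OF R'(1), of x])
    have "d *\<^sub>R y \<in> U" if "d \<in> ball c (min e 1)" "y \<in> Y" for d y
    proof -
      have d: "\<bar>d - c\<bar> < e" "\<bar>d\<bar> \<le> 2 ^ k" using that(1) k by (auto simp: dist_real_def)
      have "c *\<^sub>R x + (d *\<^sub>R (y - x) + (d - c) *\<^sub>R x) \<in> U"
        using V(2) R(2) R'(2) bspec[OF Y(3) that(2)] e(2)[OF d(1)] d(2) by blast
      then show ?thesis by (simp add: algebra_simps)
    qed
    moreover have "c \<in> ball c (min e 1)" using e(1) by simp
    ultimately show "\<exists>X Y. openin euclidean X \<and> openin ?T Y \<and> c \<in> X \<and> x \<in> Y \<and>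
        X \<times> Y \<subseteq> {p. fst p *\<^sub>R snd p \<in> U}"
      using Y(1,2) by (intro exI[of _ "ball c (min e 1)"] exI[of _ Y]) (auto simp del: mem_ball)
  qed
  then show ?thesis by (simp add: continuous_map_def topspace_base_topology case_prod_beta)
qed

lemma locally_solid_base_topology: "locally_solid_topology UNIV (base_topology B)"
  unfolding locally_solid_topology_def
proof (intro conjI allI impI)
  fix U assume "openin (base_topology B) U" "0 \<in> U"
  then obtain V where V: "V \<in> B" "\<forall>v\<in>V. 0 + v \<in> U" unfolding openin_base_topology by blast
  obtain W where "openin (base_topology B) W" "0 \<in> W" "\<forall>w\<in>W. w - 0 \<in> V"
    by (rule base_nbhd[OF V(1), of 0])
  moreover have "solid_in UNIV V" using solid[OF V(1)] by (auto simp: solid_in_def)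
  ultimately show "\<exists>V W. solid_in UNIV V \<and> V \<subseteq> U \<and> openin (base_topology B) W \<and> 0 \<in> W \<and> W \<subseteq> V"
    using V(2) by (intro exI[of _ V] exI[of _ W]) auto
qed (simp_all add: topspace_base_topology continuous_map_base_add continuous_map_base_scaleR)

lemma limitin_base_topology:
  "limitin (base_topology B) x l G \<longleftrightarrow> (\<forall>V\<in>B. eventually (\<lambda>i. x i - l \<in> V) G)"
proof (intro iffI ballI)
  fix V assume lim: "limitin (base_topology B) x l G" and "V \<in> B"
  obtain W where W: "openin (base_topology B) W" "l \<in> W" "\<forall>w\<in>W. w - l \<in> V"
    by (rule base_nbhd[OF \<open>V \<in> B\<close>, of l])
  show "eventually (\<lambda>i. x i - l \<in> V) G"
    using limitinD[OF lim W(1,2)] by eventually_elim (use W(3) in blast)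
next
  assume ev: "\<forall>V\<in>B. eventually (\<lambda>i. x i - l \<in> V) G"
  have "eventually (\<lambda>i. x i \<in> U) G" if U: "openin (base_topology B) U" "l \<in> U" for U
  proof -
    from U obtain V where V: "V \<in> B" "\<forall>v\<in>V. l + v \<in> U" unfolding openin_base_topology by blast
    from ev V(1) have "eventually (\<lambda>i. x i - l \<in> V) G" by blast
    then show ?thesis
    proof eventually_elim
      case (elim i)
      with V(2) have "l + (x i - l) \<in> U" by blast
      then show ?case by simp
    qed
  qed
  then show "limitin (base_topology B) x l G" by (simp add: limitin_def topspace_base_topology)
qed

lemma Hausdorff_base_topology:
  assumes "\<And>z. z \<noteq> 0 \<Longrightarrow> \<exists>V\<in>B. z \<notin> V"
  shows "Hausdorff_space (base_topology B)"
  unfolding Hausdorff_space_def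
proof (intro allI impI)
  fix x y assume "x \<in> topspace (base_topology B) \<and> y \<in> topspace (base_topology B) \<and> x \<noteq> y"
  then have "y - x \<noteq> 0" by auto
  then obtain V where V: "V \<in> B" "y - x \<notin> V" using assms by blast
  obtain R where R: "R \<in> B" "\<forall>a\<in>R. \<forall>b\<in>R. a + b \<in> V" using add[OF V(1)] by blast
  obtain X where X: "openin (base_topology B) X" "x \<in> X" "\<forall>w\<in>X. w - x \<in> R"
    by (rule base_nbhd[OF R(1), of x])
  obtain Y where Y: "openin (base_topology B) Y" "y \<in> Y" "\<forall>w\<in>Y. w - y \<in> R"
    by (rule base_nbhd[OF R(1), of y])
  \<comment> \<open>A common point \<open>p\<close> would give
    \<open>y - x = (p - x) + (y - p)\<close>, an element of \<open>V\<close>.\<close>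
  have False if "p \<in> X" "p \<in> Y" for p
  proof -
    have "y - p \<in> R" by (rule solid[OF R(1) bspec[OF Y(3) that(2)]]) (simp add: abs_minus_commute)
    with R(2) bspec[OF X(3) that(1)] have "(p - x) + (y - p) \<in> V" by blast
    with V(2) show False by simp
  qed
  with X Y show "\<exists>U V. openin (base_topology B) U \<and> openin (base_topology B) V \<and>
      x \<in> U \<and> y \<in> V \<and> disjnt U V"
    by (intro exI[of _ X] exI[of _ Y]) (auto simp: disjnt_iff)
qed

end


section \<open>The unbounded absolute weak topology\<close>

lemma inf_in_lattice_ideal:
  assumes "lattice_ideal F" "s \<in> F"
  shows "inf \<bar>x\<bar> \<bar>s\<bar> \<in> F"
  by (rule lattice_ideal_le[OF assms(1) lattice_ideal_parts(3)[OF assms]]) simp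

text \<open>A dominating net in the whole lattice is replaced by its infimum with \<open>\<bar>s\<bar>\<close>, which lies in \<open>F\<close>.\<close>

lemma order_convergent_in_ideal:
  fixes x :: "'i \<Rightarrow> 'a::archimedean_vector_lattice"
  assumes F: "lattice_ideal F" and s: "s \<in> F" and x: "order_convergent UNIV I r x 0"
    and bdd: "\<And>i. \<bar>x i\<bar> \<le> \<bar>s\<bar>"
  shows "order_convergent F I r x 0"
proof -
  obtain J :: "'a set" and q y where y: "decreases_to_zero UNIV J q y"
    and dom: "\<forall>b\<in>J. \<exists>a\<in>I. \<forall>c\<in>I. (a, c) \<in> r \<longrightarrow> \<bar>0 - x c\<bar> \<le> y b"
    using x by (auto simp: order_convergent_def)
  have pos: "0 \<le> y b" if "b \<in> J" for b using y that by (simp add: decreases_to_zero_def)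
  have "decreases_to_zero F J q (\<lambda>b. inf (y b) \<bar>s\<bar>)"
    unfolding decreases_to_zero_def
  proof (intro conjI ballI impI)
    show "directed_set J q" using y by (simp add: decreases_to_zero_def)
    show "(\<lambda>b. inf (y b) \<bar>s\<bar>) ` J \<subseteq> F"
    proof clarify
      fix b assume "b \<in> J"
      then show "inf (y b) \<bar>s\<bar> \<in> F"
        using inf_in_lattice_ideal[OF F s, of "y b"] pos by (simp add: abs_of_nonneg)
    qed
    show "inf (y b) \<bar>s\<bar> \<le> inf (y a) \<bar>s\<bar>" if "a \<in> J" "b \<in> J" "(a, b) \<in> q" for a b
      using y that by (auto simp: decreases_to_zero_def intro: le_infI1)
    show "0 \<le> inf (y b) \<bar>s\<bar>" if "b \<in> J" for b using pos[OF that] by simp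
    show "z \<le> 0" if "\<forall>b\<in>J. z \<le> inf (y b) \<bar>s\<bar>" for z
      using y that by (auto simp: decreases_to_zero_def)
  qed
  then show ?thesis
  proof (rule order_convergentI_any_net[rotated 2])
    show "x ` I \<subseteq> F"
      using lattice_ideal_le[OF F lattice_ideal_parts(3)[OF F s] bdd] by blast
    show "0 \<in> F" by (rule subspace_0[OF lattice_idealD(1)[OF F]])
    show "\<forall>b\<in>J. \<exists>a\<in>I. \<forall>c\<in>I. (a, c) \<in> r \<longrightarrow> \<bar>0 - x c\<bar> \<le> inf (y b) \<bar>s\<bar>"
    proof
      fix b assume "b \<in> J"
      with dom obtain a where "a \<in> I" "\<forall>c\<in>I. (a, c) \<in> r \<longrightarrow> \<bar>0 - x c\<bar> \<le> y b" by blast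
      with bdd show "\<exists>a\<in>I. \<forall>c\<in>I. (a, c) \<in> r \<longrightarrow> \<bar>0 - x c\<bar> \<le> inf (y b) \<bar>s\<bar>"
        by (intro bexI[of _ a]) auto
    qed
  qed
qed

text \<open>Truncation at \<open>\<bar>s\<bar>\<close> destroys homogeneity, so this is in general
  no seminorm; monotonicity, subadditivity and continuity in the scalar at zero remain.\<close>

definition unbounded_seminorm ::
    "'a::archimedean_vector_lattice set \<Rightarrow> ('a \<Rightarrow> real) \<Rightarrow> 'a \<Rightarrow> 'a \<Rightarrow> real" where
  "unbounded_seminorm F \<phi> s x = modulus F \<phi> (inf \<bar>x\<bar> \<bar>s\<bar>)"

text \<open>The empty \<open>Q\<close> contributes the whole space, so the base is nonempty even if
  \<open>A\<close> or \<open>S\<close> is empty.\<close>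

definition unbounded_base ::
    "'a::archimedean_vector_lattice set \<Rightarrow> ('a \<Rightarrow> real) set \<Rightarrow> 'a set \<Rightarrow> 'a set set" where
  "unbounded_base F A S = {{x. \<forall>(\<phi>, s)\<in>Q. unbounded_seminorm F \<phi> s x < e} | Q e.
     finite Q \<and> Q \<subseteq> A \<times> S \<and> 0 < e}"

lemma unbounded_baseE:
  assumes "V \<in> unbounded_base F A S"
  obtains Q e where "V = {x. \<forall>(\<phi>, s)\<in>Q. unbounded_seminorm F \<phi> s x < e}"
    "finite Q" "Q \<subseteq> A \<times> S" "0 < e"
  using assms unfolding unbounded_base_def mem_Collect_eq by (elim exE conjE)

context
  fixes F :: "'a::archimedean_vector_lattice set" and \<phi> :: "'a \<Rightarrow> real" and s :: 'a
  assumes F: "lattice_ideal F" and \<phi>: "\<phi> \<in> oc_dual F" and s: "s \<in> F"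
begin

lemma unbounded_seminorm_nonneg: "0 \<le> unbounded_seminorm F \<phi> s x"
  unfolding unbounded_seminorm_def
  by (rule modulus_nonneg[OF F \<phi> inf_in_lattice_ideal[OF F s]]) simp

lemma unbounded_seminorm_zero: "unbounded_seminorm F \<phi> s 0 = 0"
  by (simp add: unbounded_seminorm_def inf_absorb1 modulus_zero[OF F \<phi>])

lemma unbounded_seminorm_mono:
  assumes "\<bar>x\<bar> \<le> \<bar>y\<bar>"
  shows "unbounded_seminorm F \<phi> s x \<le> unbounded_seminorm F \<phi> s y"
  unfolding unbounded_seminorm_def
  by (rule modulus_mono[OF F \<phi> inf_in_lattice_ideal[OF F s]]) (use assms in \<open>auto intro: le_infI1\<close>)

lemma unbounded_seminorm_triangle:
  "unbounded_seminorm F \<phi> s (x + y) \<le> unbounded_seminorm F \<phi> s x + unbounded_seminorm F \<phi> s y"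
proof -
  let ?x = "inf \<bar>x\<bar> \<bar>s\<bar>" and ?y = "inf \<bar>y\<bar> \<bar>s\<bar>"
  have in_F: "?x \<in> F" "?y \<in> F" "?x + ?y \<in> F"
    using inf_in_lattice_ideal[OF F s] lattice_idealD(1)[OF F] by (auto intro: subspace_add)
  have "inf \<bar>x + y\<bar> \<bar>s\<bar> \<le> inf (\<bar>x\<bar> + \<bar>y\<bar>) \<bar>s\<bar>"
    using abs_triangle_ineq[of x y] by (rule inf_mono) simp
  also have "\<dots> \<le> ?x + ?y" by (rule inf_add_le_add_inf) simp_all
  finally have "unbounded_seminorm F \<phi> s (x + y) \<le> modulus F \<phi> (?x + ?y)"
    unfolding unbounded_seminorm_def by (intro modulus_mono[OF F \<phi> in_F(3)]) simp_all
  then show ?thesis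
    using modulus_add[OF F \<phi> in_F(1) _ in_F(2)] by (simp add: unbounded_seminorm_def)
qed

text \<open>By the Archimedean property the truncated multiples of \<open>x\<close> by
  \<open>inverse (real (Suc n))\<close> are order null, so the order continuous modulus makes one of
  them small. Monotonicity extends this to all smaller scalars.\<close>

lemma unbounded_seminorm_scale:
  assumes "0 < e"
  shows "\<exists>d>0. \<forall>c. \<bar>c\<bar> < d \<longrightarrow> unbounded_seminorm F \<phi> s (c *\<^sub>R x) < e"
proof -
  let ?w = "\<lambda>n. inf \<bar>inverse (real (Suc n)) *\<^sub>R x\<bar> \<bar>s\<bar>"
  have "order_convergent UNIV UNIV {(m, n). m \<le> n} ?w 0"
  proof (rule order_convergentI_any_net[OF _ _ decreases_to_zero_inverse[of UNIV "\<bar>x\<bar>"]])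
    have le: "?w n \<le> inverse (real (Suc m)) *\<^sub>R \<bar>x\<bar>" if "m \<le> n" for m n
    proof -
      have "?w n \<le> inverse (real (Suc n)) *\<^sub>R \<bar>x\<bar>" by (simp add: abs_scaleR_lattice)
      also have "\<dots> \<le> inverse (real (Suc m)) *\<^sub>R \<bar>x\<bar>"
        using that by (intro scaleR_right_mono le_imp_inverse_le) auto
      finally show ?thesis .
    qed
    show "\<forall>m\<in>UNIV. \<exists>a\<in>UNIV. \<forall>n\<in>UNIV. (a, n) \<in> {(m, n). m \<le> n} \<longrightarrow>
        \<bar>0 - ?w n\<bar> \<le> inverse (real (Suc m)) *\<^sub>R \<bar>x\<bar>"
    proof
      fix m
      show "\<exists>a\<in>UNIV. \<forall>n\<in>UNIV. (a, n) \<in> {(m, n). m \<le> n} \<longrightarrow>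
          \<bar>0 - ?w n\<bar> \<le> inverse (real (Suc m)) *\<^sub>R \<bar>x\<bar>"
        using le[of m] abs_minus_commute[of 0 "?w _"] by (intro bexI[of _ m]) (simp_all del: diff_inf_eq_sup)
    qed
  qed simp_all
  then have "order_convergent F UNIV {(m, n). m \<le> n} ?w 0"
    by (rule order_convergent_in_ideal[OF F s]) simp
  from modulus_order_continuous[OF F \<phi> directed_set_nat this]
  have "eventually (\<lambda>n. dist (modulus F \<phi> \<bar>?w n\<bar>) 0 < e) (tails UNIV {(m, n). m \<le> n})"
    using assms by (rule tendstoD)
  then obtain n where n: "dist (modulus F \<phi> \<bar>?w n\<bar>) 0 < e"
    unfolding eventually_tails[OF directed_set_nat] by auto
  then have small: "unbounded_seminorm F \<phi> s (inverse (real (Suc n)) *\<^sub>R x) < e"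
    by (simp add: dist_real_def unbounded_seminorm_def)
  have "unbounded_seminorm F \<phi> s (c *\<^sub>R x) < e" if "\<bar>c\<bar> < inverse (real (Suc n))" for c
  proof (rule le_less_trans[OF unbounded_seminorm_mono small])
    show "\<bar>c *\<^sub>R x\<bar> \<le> \<bar>inverse (real (Suc n)) *\<^sub>R x\<bar>"
      using that by (simp add: abs_scaleR_lattice scaleR_right_mono)
  qed
  then show ?thesis by (intro exI[of _ "inverse (real (Suc n))"]) simp
qed

lemma unbounded_seminorm_uo:
  assumes dir: "directed_set I r" and x: "uo_convergent I r x l"
  shows "((\<lambda>i. unbounded_seminorm F \<phi> s (x i - l)) \<longlongrightarrow> 0) (tails I r)"
proof -
  have "order_convergent UNIV I r (\<lambda>i. inf \<bar>x i - l\<bar> \<bar>s\<bar>) 0"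
    using x by (simp add: uo_convergent_def)
  then have "order_convergent F I r (\<lambda>i. inf \<bar>x i - l\<bar> \<bar>s\<bar>) 0"
    by (rule order_convergent_in_ideal[OF F s]) simp
  from modulus_order_continuous[OF F \<phi> dir this] show ?thesis
    by (simp add: unbounded_seminorm_def)
qed

end

context
  fixes F :: "'a::archimedean_vector_lattice set" and A S
  assumes F: "lattice_ideal F" and A: "A \<subseteq> oc_dual F" and S: "S \<subseteq> F"
begin

lemma unbounded_base_solid_base: "solid_base (unbounded_base F A S)"
proof
  let ?N = "\<lambda>Q e. {x. \<forall>(\<phi>, s)\<in>Q. unbounded_seminorm F \<phi> s x < e}"
  have I: "?N Q e \<in> unbounded_base F A S" if "finite Q" "Q \<subseteq> A \<times> S" "0 < e" for Q e
    using that unfolding unbounded_base_def by blast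
  have "?N {} 1 \<in> unbounded_base F A S" by (rule I) simp_all
  then show "unbounded_base F A S \<noteq> {}" by auto
  fix V assume "V \<in> unbounded_base F A S"
  then obtain Q e where V: "V = ?N Q e" "finite Q" "Q \<subseteq> A \<times> S" "0 < e"
    by (rule unbounded_baseE)
  have Q: "\<phi> \<in> oc_dual F" "s \<in> F" if "(\<phi>, s) \<in> Q" for \<phi> s using V(3) that A S by auto
  show "0 \<in> V" using V(4) Q by (auto simp: V(1) unbounded_seminorm_zero[OF F])
  show "x \<in> V" if "y \<in> V" "\<bar>x\<bar> \<le> \<bar>y\<bar>" for x y
  proof -
    have "unbounded_seminorm F \<phi> s x < e" if "(\<phi>, s) \<in> Q" for \<phi> s
    proof (rule le_less_trans[OF unbounded_seminorm_mono[OF F Q[OF that] \<open>\<bar>x\<bar> \<le> \<bar>y\<bar>\<close>]])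
      show "unbounded_seminorm F \<phi> s y < e" using \<open>y \<in> V\<close> that by (auto simp: V(1))
    qed
    then show ?thesis by (auto simp: V(1))
  qed
  show "\<exists>R\<in>unbounded_base F A S. R \<subseteq> V \<inter> W" if "W \<in> unbounded_base F A S" for W
  proof -
    from that obtain Q' e' where W: "W = ?N Q' e'" "finite Q'" "Q' \<subseteq> A \<times> S" "0 < e'"
      by (rule unbounded_baseE)
    have "?N (Q \<union> Q') (min e e') \<in> unbounded_base F A S" using V W by (intro I) auto
    moreover have "?N (Q \<union> Q') (min e e') \<subseteq> V \<inter> W" by (auto simp: V(1) W(1))
    ultimately show ?thesis by blast
  qed
  show "\<exists>W\<in>unbounded_base F A S. \<forall>a\<in>W. \<forall>b\<in>W. a + b \<in> V"
  proof (intro bexI ballI)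
    show "?N Q (e / 2) \<in> unbounded_base F A S" using V by (intro I) auto
    fix a b assume ab: "a \<in> ?N Q (e / 2)" "b \<in> ?N Q (e / 2)"
    have "unbounded_seminorm F \<phi> s (a + b) < e" if "(\<phi>, s) \<in> Q" for \<phi> s
    proof -
      have "unbounded_seminorm F \<phi> s a < e / 2" "unbounded_seminorm F \<phi> s b < e / 2"
        using ab that by auto
      then show ?thesis using unbounded_seminorm_triangle[OF F Q[OF that], of a b] by simp
    qed
    then show "a + b \<in> V" by (auto simp: V(1))
  qed
  show "\<exists>d>0. \<forall>c. \<bar>c\<bar> < d \<longrightarrow> c *\<^sub>R x \<in> V" for x
  proof -
    have "\<exists>d>0. \<forall>c. \<bar>c\<bar> < d \<longrightarrow> unbounded_seminorm F (fst q) (snd q) (c *\<^sub>R x) < e" if "q \<in> Q" for q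
    proof (rule unbounded_seminorm_scale[OF F Q V(4)])
      show "(fst q, snd q) \<in> Q" "(fst q, snd q) \<in> Q" using that by simp_all
    qed
    then obtain d where d: "\<And>q. q \<in> Q \<Longrightarrow> 0 < d q"
      "\<And>q c. q \<in> Q \<Longrightarrow> \<bar>c\<bar> < d q \<Longrightarrow> unbounded_seminorm F (fst q) (snd q) (c *\<^sub>R x) < e" by metis
    \<comment> \<open>Inserting 1 keeps the minimum defined when \<open>Q\<close> is empty.\<close>
    have "\<forall>c. \<bar>c\<bar> < Min (insert 1 (d ` Q)) \<longrightarrow> c *\<^sub>R x \<in> V"
      using V(2) d(2) by (fastforce simp: V(1))
    moreover have "0 < Min (insert 1 (d ` Q))" using V(2) d(1) by simp
    ultimately show ?thesis by blast
  qed
qed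

lemma limitin_unbounded_base:
  "limitin (base_topology (unbounded_base F A S)) x l G \<longleftrightarrow>
     (\<forall>\<phi>\<in>A. \<forall>s\<in>S. ((\<lambda>i. unbounded_seminorm F \<phi> s (x i - l)) \<longlongrightarrow> 0) G)"
  unfolding solid_base.limitin_base_topology[OF unbounded_base_solid_base]
proof (intro iffI ballI)
  note sub = subsetD[OF A] subsetD[OF S]
  let ?N = "\<lambda>Q e. {x. \<forall>(\<phi>, s)\<in>Q. unbounded_seminorm F \<phi> s x < e}"
  fix \<phi> s
  assume ev: "\<forall>V\<in>unbounded_base F A S. eventually (\<lambda>i. x i - l \<in> V) G" and q: "\<phi> \<in> A" "s \<in> S"
  show "((\<lambda>i. unbounded_seminorm F \<phi> s (x i - l)) \<longlongrightarrow> 0) G"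
  proof (rule tendstoI)
    fix e :: real assume "0 < e"
    with q have "?N {(\<phi>, s)} e \<in> unbounded_base F A S" unfolding unbounded_base_def by blast
    with ev have "eventually (\<lambda>i. x i - l \<in> ?N {(\<phi>, s)} e) G" by blast
    then show "eventually (\<lambda>i. dist (unbounded_seminorm F \<phi> s (x i - l)) 0 < e) G"
      by (simp add: dist_real_def unbounded_seminorm_nonneg[OF F sub(1)[OF q(1)] sub(2)[OF q(2)]])
  qed
next
  fix V
  assume lim: "\<forall>\<phi>\<in>A. \<forall>s\<in>S. ((\<lambda>i. unbounded_seminorm F \<phi> s (x i - l)) \<longlongrightarrow> 0) G"
    and "V \<in> unbounded_base F A S"
  from this(2) obtain Q e where V: "V = {x. \<forall>(\<phi>, s)\<in>Q. unbounded_seminorm F \<phi> s x < e}"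
    "finite Q" "Q \<subseteq> A \<times> S" "0 < e" by (rule unbounded_baseE)
  have "\<forall>q\<in>Q. eventually (\<lambda>i. unbounded_seminorm F (fst q) (snd q) (x i - l) < e) G"
    using lim V(3,4) by (auto intro!: order_tendstoD(2))
  from eventually_ball_finite[OF V(2) this]
  show "eventually (\<lambda>i. x i - l \<in> V) G"
    by eventually_elim (auto simp: V(1))
qed

lemma uo_Lebesgue_unbounded_base: "uo_Lebesgue (base_topology (unbounded_base F A S))"
  unfolding uo_Lebesgue_def limitin_unbounded_base
  using solid_base.locally_solid_base_topology[OF unbounded_base_solid_base]
    unbounded_seminorm_uo[OF F subsetD[OF A] subsetD[OF S]] by blast

text \<open>If \<open>x\<close> lies in all members of the base, every modulus from \<open>A\<close>
  vanishes at \<open>inf \<bar>x\<bar> \<bar>s\<bar>\<close>. By \<open>oc_dual_ideal_null\<close>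
  so does every modulus from the generated ideal, which separates points, so \<open>x\<close> is
  disjoint from \<open>S\<close>. The disjoint complement of \<open>x\<close> is an ideal and hence
  contains the ideal generated by \<open>S\<close>; order density then gives a positive element
  below \<open>\<bar>x\<bar>\<close> that is disjoint from \<open>x\<close>.\<close>

lemma Hausdorff_unbounded_base:
  assumes sep: "separates_points (oc_dual_ideal F hull A) F"
    and dense: "order_dense (lattice_ideal hull S)"
  shows "Hausdorff_space (base_topology (unbounded_base F A S))"
proof (rule solid_base.Hausdorff_base_topology[OF unbounded_base_solid_base], rule ccontr)
  fix x :: 'a assume "x \<noteq> 0" and "\<not> (\<exists>V\<in>unbounded_base F A S. x \<notin> V)"
  then have inN: "\<forall>V\<in>unbounded_base F A S. x \<in> V" by simp
  have null: "unbounded_seminorm F \<phi> s x = 0" if "\<phi> \<in> A" "s \<in> S" for \<phi> s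
  proof -
    have "unbounded_seminorm F \<phi> s x \<le> e" if "0 < e" for e
    proof -
      have "{x. \<forall>(\<phi>, s)\<in>{(\<phi>, s)}. unbounded_seminorm F \<phi> s x < e} \<in> unbounded_base F A S"
        using that \<open>\<phi> \<in> A\<close> \<open>s \<in> S\<close> unfolding unbounded_base_def by blast
      from bspec[OF inN this] show ?thesis by simp
    qed
    then have "unbounded_seminorm F \<phi> s x \<le> 0" by (rule dense_ge)
    then show ?thesis
      using unbounded_seminorm_nonneg[OF F subsetD[OF A that(1)] subsetD[OF S that(2)], of x] by simp
  qed
  have disjoint: "inf \<bar>x\<bar> \<bar>s\<bar> = 0" if s: "s \<in> S" for s
  proof -
    let ?w = "inf \<bar>x\<bar> \<bar>s\<bar>"
    have w: "?w \<in> F" "0 \<le> ?w" using inf_in_lattice_ideal[OF F subsetD[OF S s]] by simp_all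
    have "A \<subseteq> {\<phi> \<in> oc_dual F. modulus F \<phi> ?w = 0}"
      using A null[OF _ s] by (auto simp: unbounded_seminorm_def)
    then have hull: "oc_dual_ideal F hull A \<subseteq> {\<phi> \<in> oc_dual F. modulus F \<phi> ?w = 0}"
      using oc_dual_ideal_null[OF F w] by (rule hull_minimal)
    have "\<psi> ?w = \<psi> 0" if "\<psi> \<in> oc_dual_ideal F hull A" for \<psi>
    proof -
      from hull that have \<psi>: "\<psi> \<in> oc_dual F" "modulus F \<psi> ?w = 0" by auto
      have "\<bar>\<psi> ?w\<bar> \<le> modulus F \<psi> ?w" by (rule le_modulus[OF F \<psi>(1) w(1)]) simp
      with \<psi>(2) functional_on_zero[OF oc_dual_functional[OF F \<psi>(1)]] show ?thesis by simp
    qed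
    then show ?thesis
      using sep w(1) subspace_0[OF lattice_idealD(1)[OF F]] unfolding separates_points_def by blast
  qed
  have "lattice_ideal {y. inf \<bar>x\<bar> \<bar>y\<bar> = 0}"
  proof -
    have solid: "inf \<bar>x\<bar> \<bar>y\<bar> = 0" if "inf \<bar>x\<bar> z = 0" "\<bar>y\<bar> \<le> z" for y z
    proof (rule antisym)
      show "inf \<bar>x\<bar> \<bar>y\<bar> \<le> 0" using inf_mono[OF order_refl that(2), of "\<bar>x\<bar>"] that(1) by simp
    qed simp
    have add: "inf \<bar>x\<bar> (a + b) = 0" if "inf \<bar>x\<bar> a = 0" "inf \<bar>x\<bar> b = 0" "0 \<le> a" "0 \<le> b" for a b
      using inf_add_le_add_inf[OF that(3,4), of "\<bar>x\<bar>"] that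
      by (intro antisym) (simp_all add: inf_commute)
    \<comment> \<open>Repeated addition reaches the natural multiples only; other scalars are
      rounded up and treated by solidity.\<close>
    have mult: "inf \<bar>x\<bar> (real n *\<^sub>R \<bar>y\<bar>) = 0" if "inf \<bar>x\<bar> \<bar>y\<bar> = 0" for n y
    proof (induction n)
      case (Suc n)
      have "real (Suc n) *\<^sub>R \<bar>y\<bar> = \<bar>y\<bar> + real n *\<^sub>R \<bar>y\<bar>" by (simp add: algebra_simps)
      then show ?case using add[OF that Suc] by (simp add: scaleR_nonneg_nonneg)
    qed (simp add: inf_absorb2)
    show ?thesis
      unfolding lattice_ideal_def solid_in_def subspace_def
    proof (intro conjI ballI allI impI; (unfold mem_Collect_eq)?)
      show "inf \<bar>x\<bar> \<bar>0\<bar> = 0" by (simp add: inf_absorb2)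
      show "inf \<bar>x\<bar> \<bar>a + b\<bar> = 0" if "inf \<bar>x\<bar> \<bar>a\<bar> = 0" "inf \<bar>x\<bar> \<bar>b\<bar> = 0" for a b
        by (rule solid[OF add[OF that] abs_triangle_ineq]) simp_all
      show "inf \<bar>x\<bar> \<bar>c *\<^sub>R y\<bar> = 0" if "inf \<bar>x\<bar> \<bar>y\<bar> = 0" for c y
      proof (rule solid[OF mult[OF that]])
        show "\<bar>c *\<^sub>R y\<bar> \<le> real (nat \<lceil>\<bar>c\<bar>\<rceil>) *\<^sub>R \<bar>y\<bar>"
          by (simp add: abs_scaleR_lattice scaleR_right_mono of_nat_ceiling)
      qed
      show "inf \<bar>x\<bar> \<bar>y\<bar> = 0" if "inf \<bar>x\<bar> \<bar>z\<bar> = 0" "\<bar>y\<bar> \<le> \<bar>z\<bar>" for y z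
        by (rule solid[OF that])
    qed simp
  qed
  then have "lattice_ideal hull S \<subseteq> {y. inf \<bar>x\<bar> \<bar>y\<bar> = 0}"
    using disjoint by (intro hull_minimal) auto
  moreover have "0 < \<bar>x\<bar>" using \<open>x \<noteq> 0\<close> by (simp add: order_less_le)
  then obtain y where "y \<in> lattice_ideal hull S" "0 < y" "y \<le> \<bar>x\<bar>"
    using dense unfolding order_dense_def by blast
  ultimately have "inf \<bar>x\<bar> \<bar>y\<bar> = 0" "inf \<bar>x\<bar> \<bar>y\<bar> = y" "0 < y"
    by (auto simp: abs_of_nonneg less_imp_le inf_absorb2)
  then show False by simp
qed

section \<open>Convergence in the absolute weak topology and its unbounded version\<close>

text \<open>The balls about zero give one direction. For the other, a ball of radius
  \<open>e\<close> about \<open>a\<close> that contains zero has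
  \<open>modulus F \<phi> \<bar>a\<bar> < e\<close>, so by the triangle inequality it contains every
  \<open>y i\<close> at which the modulus is small enough. Induction over the generated topology
  passes from the subbase to all open sets.\<close>

lemma limitin_abs_weak_zero:
  assumes y: "\<And>i. y i \<in> F"
  shows "limitin (abs_weak_topology F A) y 0 G \<longleftrightarrow> (\<forall>\<phi>\<in>A. ((\<lambda>i. modulus F \<phi> \<bar>y i\<bar>) \<longlongrightarrow> 0) G)"
proof (intro iffI ballI)
  note zero = subspace_0[OF lattice_idealD(1)[OF F]]
  let ?B = "{{x \<in> F. modulus F \<phi> \<bar>x - a\<bar> < e} | \<phi> a e. \<phi> \<in> A \<and> a \<in> F \<and> 0 < e}"
  note pos = modulus_nonneg[OF F subsetD[OF A] lattice_ideal_parts(3)[OF F]]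
  fix \<phi>
  assume lim: "limitin (abs_weak_topology F A) y 0 G" and \<phi>: "\<phi> \<in> A"
  show "((\<lambda>i. modulus F \<phi> \<bar>y i\<bar>) \<longlongrightarrow> 0) G"
  proof (rule tendstoI)
    fix e :: real assume e: "0 < e"
    let ?U = "{x \<in> F. modulus F \<phi> \<bar>x - 0\<bar> < e}"
    have "?U \<in> ?B" using \<phi> e zero by blast
    then have "openin (abs_weak_topology F A) ?U"
      unfolding abs_weak_topology_def by (intro topology_generated_by_Basis) simp
    moreover have "0 \<in> ?U" using e zero modulus_zero[OF F subsetD[OF A \<phi>]] by simp
    ultimately have "eventually (\<lambda>i. y i \<in> ?U) G" using limitinD[OF lim] by blast
    then show "eventually (\<lambda>i. dist (modulus F \<phi> \<bar>y i\<bar>) 0 < e) G"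
      by eventually_elim (use pos[OF \<phi> y] in \<open>simp add: dist_real_def\<close>)
  qed
next
  note zero = subspace_0[OF lattice_idealD(1)[OF F]]
  let ?B = "{{x \<in> F. modulus F \<phi> \<bar>x - a\<bar> < e} | \<phi> a e. \<phi> \<in> A \<and> a \<in> F \<and> 0 < e}"
  assume lim: "\<forall>\<phi>\<in>A. ((\<lambda>i. modulus F \<phi> \<bar>y i\<bar>) \<longlongrightarrow> 0) G"
  have basic: "eventually (\<lambda>i. y i \<in> U) G"
    if U: "U = {x \<in> F. modulus F \<phi> \<bar>x - a\<bar> < e}" and \<phi>: "\<phi> \<in> A" and a: "a \<in> F" and "0 \<in> U" for U \<phi> a e
  proof -
    note oc = subsetD[OF A \<phi>]
    have "modulus F \<phi> \<bar>a\<bar> < e" using U \<open>0 \<in> U\<close> by simp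
    then have "eventually (\<lambda>i. modulus F \<phi> \<bar>y i\<bar> < e - modulus F \<phi> \<bar>a\<bar>) G"
      using lim \<phi> by (intro order_tendstoD(2)) auto
    then show ?thesis
    proof eventually_elim
      case (elim i)
      note parts = lattice_ideal_parts(3)[OF F y] lattice_ideal_parts(3)[OF F a]
      have "modulus F \<phi> \<bar>y i - a\<bar> \<le> modulus F \<phi> (\<bar>y i\<bar> + \<bar>a\<bar>)"
        using parts lattice_idealD(1)[OF F] abs_triangle_ineq4[of "y i" a]
        by (intro modulus_mono[OF F oc]) (auto intro: subspace_add)
      also have "\<dots> = modulus F \<phi> \<bar>y i\<bar> + modulus F \<phi> \<bar>a\<bar>"
        by (rule modulus_add[OF F oc parts(1) _ parts(2)]) simp_all
      finally show ?case using elim y by (simp add: U)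
    qed
  qed
  have "eventually (\<lambda>i. y i \<in> U) G"
    if "generate_topology_on (insert F ?B) U" "0 \<in> U" for U
    using that
  proof induction
    case (Int U V)
    then show ?case by (simp add: eventually_conj)
  next
    case (UN K)
    then obtain U where "U \<in> K" "0 \<in> U" by blast
    with UN.IH have "eventually (\<lambda>i. y i \<in> U) G" by blast
    then show ?case by eventually_elim (use \<open>U \<in> K\<close> in blast)
  next
    case (Basis U)
    then show ?case using basic y by auto
  qed simp
  moreover have "0 \<in> topspace (abs_weak_topology F A)"
    using zero by (simp add: abs_weak_topology_def)
  ultimately show "limitin (abs_weak_topology F A) y 0 G"
    unfolding limitin_def abs_weak_topology_def openin_topology_generated_by_iff by blast
qed

lemma is_unbounded_topology_unbounded_base:
  "is_unbounded_topology S (abs_weak_topology F A) (base_topology (unbounded_base F A S))"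
  unfolding is_unbounded_topology_def
proof (intro conjI allI impI)
  show "group_topology (base_topology (unbounded_base F A S))"
    using solid_base.locally_solid_base_topology[OF unbounded_base_solid_base]
    by (rule locally_solid_imp_group_topology)
  fix I :: "('a \<times> 'a set) set" and r x
  have "limitin (abs_weak_topology F A) (\<lambda>i. inf \<bar>x i\<bar> \<bar>s\<bar>) 0 (tails I r) \<longleftrightarrow>
      (\<forall>\<phi>\<in>A. ((\<lambda>i. unbounded_seminorm F \<phi> s (x i)) \<longlongrightarrow> 0) (tails I r))" if "s \<in> S" for s
    using limitin_abs_weak_zero[of "\<lambda>i. inf \<bar>x i\<bar> \<bar>s\<bar>"] inf_in_lattice_ideal[OF F subsetD[OF S that]]
    by (simp add: unbounded_seminorm_def)
  then show "limitin (base_topology (unbounded_base F A S)) x 0 (tails I r) \<longleftrightarrow>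
      (\<forall>s\<in>S. limitin (abs_weak_topology F A) (\<lambda>i. inf \<bar>x i\<bar> \<bar>s\<bar>) 0 (tails I r))"
    unfolding limitin_unbounded_base by auto
qed

end

section \<open>Uniqueness of the unbounded topology\<close>

text \<open>If no \<open>W\<close> were contained in \<open>U\<close>, points chosen in
  \<open>W\<close> but outside \<open>U\<close> would form a net indexed by the \<open>W\<close>
  themselves. It converges to zero in \<open>T'\<close>, hence in \<open>T\<close>, because both
  have the same null nets, yet it avoids \<open>U\<close>.\<close>

lemma is_unbounded_topology_nbhd:
  fixes T :: "'a::archimedean_vector_lattice topology"
  assumes T: "is_unbounded_topology S TF T" and T': "is_unbounded_topology S TF T'"
    and U: "openin T U" "0 \<in> U"
  shows "\<exists>W. openin T' W \<and> 0 \<in> W \<and> W \<subseteq> U"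
proof (rule ccontr)
  define I where "I = {W. openin T' W \<and> 0 \<in> W}"
  define r where "r = {(V, W). V \<in> I \<and> W \<in> I \<and> W \<subseteq> V}"
  have top: "topspace T' = UNIV"
    using T' by (simp add: is_unbounded_topology_def group_topology_def)
  assume "\<not> ?thesis"
  then have "\<exists>x. x \<in> W \<and> x \<notin> U" if "W \<in> I" for W using that unfolding I_def by blast
  then obtain x where x: "\<And>W. W \<in> I \<Longrightarrow> x W \<in> W" "\<And>W. W \<in> I \<Longrightarrow> x W \<notin> U" by metis
  have "UNIV \<in> I" using openin_topspace[of T'] by (simp add: I_def top)
  have dir: "directed_set I r"
    unfolding directed_set_def
  proof (intro conjI ballI)
    show "I \<noteq> {}" using \<open>UNIV \<in> I\<close> by blast
    show "preorder_on I r" by (auto simp: preorder_on_def r_def refl_on_def trans_def)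
    show "\<exists>R\<in>I. (V, R) \<in> r \<and> (W, R) \<in> r" if "V \<in> I" "W \<in> I" for V W
      using that by (intro bexI[of _ "V \<inter> W"]) (auto simp: I_def r_def)
  qed
  have "eventually (\<lambda>W. x W \<in> V) (tails I r)" if "openin T' V" "0 \<in> V" for V
    unfolding eventually_tails[OF dir] using that x(1)
    by (intro bexI[of _ V]) (auto simp: I_def r_def)
  then have "limitin T' x 0 (tails I r)" by (simp add: limitin_def top)
  then have "limitin T x 0 (tails I r)"
    using is_unbounded_topology_any_net[OF T dir] is_unbounded_topology_any_net[OF T' dir] by blast
  from limitinD[OF this U] obtain W where W: "W \<in> I" "\<forall>V\<in>I. (W, V) \<in> r \<longrightarrow> x V \<in> U"
    unfolding eventually_tails[OF dir] by blast
  then have "(W, W) \<in> r" by (simp add: r_def)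
  with W x(2) show False by blast
qed

lemma unbounded_topology_eqI:
  assumes "is_unbounded_topology S TF T"
  shows "unbounded_topology S TF = T"
  unfolding unbounded_topology_def
proof (rule the_equality)
  show "is_unbounded_topology S TF T" by (rule assms)
  fix T' assume T': "is_unbounded_topology S TF T'"
  show "T' = T"
  proof (rule group_topology_eqI)
    show "group_topology T'" "group_topology T"
      using T' assms by (simp_all add: is_unbounded_topology_def)
  qed (use is_unbounded_topology_nbhd[OF T' assms] is_unbounded_topology_nbhd[OF assms T'] in blast)+
qed

theorem theorem5p2:
  fixes F :: "'a::archimedean_vector_lattice set"
  assumes "lattice_ideal F" and "order_dense F" and "separates_points (oc_dual F) F"
  shows "(\<exists>!T :: 'a topology. Hausdorff_space T \<and> uo_Lebesgue T) \<and>
    (\<forall>T :: 'a topology. Hausdorff_space T \<and> uo_Lebesgue T \<longrightarrow>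
      (\<forall>A S. A \<subseteq> oc_dual F \<and> separates_points (oc_dual_ideal F hull A) F \<and>
             S \<subseteq> F \<and> order_dense (lattice_ideal hull S) \<longrightarrow>
        unbounded_topology S (abs_weak_topology F A) = T \<and>
        unbounded_topology F (abs_weak_topology F (oc_dual_ideal F hull A)) = T \<and>
        (\<forall>(I :: 'i set) r x. directed_set I r \<longrightarrow>
          (limitin T x 0 (tails I r) \<longleftrightarrow>
            (\<forall>\<phi>\<in>A. \<forall>s\<in>S. ((\<lambda>i. modulus F \<phi> (inf \<bar>x i\<bar> \<bar>s\<bar>)) \<longlongrightarrow> 0) (tails I r))) \<and>
          (limitin T x 0 (tails I r) \<longleftrightarrow>
            (\<forall>\<phi>\<in>oc_dual F. \<forall>y\<in>F. ((\<lambda>i. modulus F \<phi> (inf \<bar>x i\<bar> \<bar>y\<bar>)) \<longlongrightarrow> 0) (tails I r))))))"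
proof -
  note F = assms(1)
  let ?T = "\<lambda>A S. base_topology (unbounded_base F A S)"
  have hull_F: "lattice_ideal hull F = F" using F by (rule hull_same)
  have hull_oc: "oc_dual_ideal F hull oc_dual F = oc_dual F"
    using oc_dual_ideal_oc_dual by (rule hull_same)
  have good: "Hausdorff_space (?T A S) \<and> uo_Lebesgue (?T A S)"
    if "A \<subseteq> oc_dual F" "separates_points (oc_dual_ideal F hull A) F"
      "S \<subseteq> F" "order_dense (lattice_ideal hull S)" for A S
    using Hausdorff_unbounded_base[OF F that(1,3,2,4)] uo_Lebesgue_unbounded_base[OF F that(1,3)]
    by blast
  \<comment> \<open>The full dual and the full ideal are their own hulls, so the hypotheses on
    \<open>F\<close> make them an admissible choice. This gives existence.\<close>
  have full: "Hausdorff_space (?T (oc_dual F) F) \<and> uo_Lebesgue (?T (oc_dual F) F)"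
    by (rule good) (use assms hull_F hull_oc in simp_all)
  show ?thesis
  proof (intro conjI allI impI; (elim conjE)?)
    show "\<exists>!T :: 'a topology. Hausdorff_space T \<and> uo_Lebesgue T"
      using full uo_Lebesgue_unique by blast
    fix T :: "'a topology" and A S
    assume T: "Hausdorff_space T" "uo_Lebesgue T"
      and A: "A \<subseteq> oc_dual F" "separates_points (oc_dual_ideal F hull A) F"
      and S: "S \<subseteq> F" "order_dense (lattice_ideal hull S)"
    \<comment> \<open>Uniqueness identifies \<open>T\<close> with every Hausdorff uo-Lebesgue
      topology of this form. The instance \<open>T1\<close> yields the first unbounded topology and
      the first criterion, \<open>T2\<close> the second topology, and \<open>T3\<close> the second
      criterion.\<close>
    have T_eq: "T = ?T A' S'"
      if "Hausdorff_space (?T A' S') \<and> uo_Lebesgue (?T A' S')" for A' S'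
      using uo_Lebesgue_unique[OF T(2,1)] that by blast
    have I_A: "oc_dual_ideal F hull A \<subseteq> oc_dual F"
      using A(1) oc_dual_ideal_oc_dual by (rule hull_minimal)
    have T1: "T = ?T A S" by (rule T_eq[OF good[OF A S]])
    have T2: "T = ?T (oc_dual_ideal F hull A) F"
      by (rule T_eq[OF good]) (use I_A A(2) assms(2) hull_F in simp_all)
    have T3: "T = ?T (oc_dual F) F" by (rule T_eq[OF full])
    show "unbounded_topology S (abs_weak_topology F A) = T"
      unfolding T1
      by (rule unbounded_topology_eqI[OF is_unbounded_topology_unbounded_base[OF F A(1) S(1)]])
    show "unbounded_topology F (abs_weak_topology F (oc_dual_ideal F hull A)) = T"
      unfolding T2
      by (rule unbounded_topology_eqI[OF is_unbounded_topology_unbounded_base[OF F I_A order_refl]])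
    fix I :: "'i set" and r x
    show "limitin T x 0 (tails I r) \<longleftrightarrow>
        (\<forall>\<phi>\<in>A. \<forall>s\<in>S. ((\<lambda>i. modulus F \<phi> (inf \<bar>x i\<bar> \<bar>s\<bar>)) \<longlongrightarrow> 0) (tails I r))"
      unfolding T1 limitin_unbounded_base[OF F A(1) S(1)] by (simp add: unbounded_seminorm_def)
    show "limitin T x 0 (tails I r) \<longleftrightarrow>
        (\<forall>\<phi>\<in>oc_dual F. \<forall>y\<in>F. ((\<lambda>i. modulus F \<phi> (inf \<bar>x i\<bar> \<bar>y\<bar>)) \<longlongrightarrow> 0) (tails I r))"
      unfolding T3 limitin_unbounded_base[OF F order_refl order_refl]
      by (simp add: unbounded_seminorm_def)
  qed
qed

end
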